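(* Let $n\ge 1$ and $\gamma>0$. Let $f,g$ be analytic functions on $\mathbb{B}_n$ and let $\varphi,\psi$ be analytic self-maps of $\mathbb{B}_n$ such that the weighted composition operators $W_{f,\varphi}$ and $W_{g,\psi}$ are bounded on $H_{\gamma}$. Then $W_{f,\varphi}W^{*}_{g,\psi}=I$ on $H_{\gamma}$ if and only if $\varphi=\psi$, this common map is an automorphism of $\mathbb{B}_n$, and there is a complex constant $\lambda\neq 0$ such that $f=\lambda k^{\gamma}_{a}$ and $g=(1/\overline{\lambda})k^{\gamma}_{a}$, where $a=\varphi^{-1}(0)$. Furthermore, in this case both $W_{f,\varphi}$ and $W_{g,\psi}$ are constant multiples of the operator $W_{k^{\gamma}_{a},\varphi}$, which is unitary.
   Context: $\mathbb{B}_n$ is the open unit ball of $\mathbb{C}^n$, with $\langle z,w\rangle=\sum_j z_j\overline{w_j}$. For $\gamma>0$, $H_{\gamma}$ is the Hilbert space of analytic functions on $\mathbb{B}_n$ with reproducing kernel $K^{\gamma}_z(w)=(1-\langle w,z\rangle)^{-\gamma}$ (principal branch), so $h(z)=\langle h,K^{\gamma}_z\rangle$ for $h\in H_\gamma$. For $a\in\mathbb{B}_n$, $k^{\gamma}_a(w)=K^\gamma_a(w)/\|K^\gamma_a\|=(1-|a|^2)^{\gamma/2}(1-\langle w,a\rangle)^{-\gamma}$. For $f$ analytic on $\mathbb{B}_n$ and $\varphi$ an analytic self-map of $\mathbb{B}_n$, the weighted composition operator is $W_{f,\varphi}h=f\cdot(h\circ\varphi)$; it is bounded on $H_\gamma$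 if it maps $H_\gamma$ into $H_\gamma$ as a bounded operator. An automorphism of $\mathbb{B}_n$ is a biholomorphic map of $\mathbb{B}_n$ onto itself. *)

theory Defs
  imports "HOL-Analysis.Analysis"
begin

abbreviation unit_ball :: "(complex ^ 'n) set"
  where "unit_ball \<equiv> ball 0 1"

definition cdot :: "complex ^ 'n \<Rightarrow> complex ^ 'n \<Rightarrow> complex"
  where "cdot z w = (\<Sum>j\<in>UNIV. z $ j * cnj (w $ j))"

(* Analyticity in several variables, for open S: the real Frechet derivative exists
   at every point and is complex linear. *)
definition analytic_fun_on :: "(complex ^ 'n) set \<Rightarrow> (complex ^ 'n \<Rightarrow> complex) \<Rightarrow> bool"
  where "analytic_fun_on S f \<longleftrightarrow>
    (\<forall>z\<in>S. \<exists>D. (f has_derivative D) (at z) \<and> (\<forall>c v. D (c *s v) = c * D v))"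

definition analytic_map_on :: "(complex ^ 'n) set \<Rightarrow> (complex ^ 'n \<Rightarrow> complex ^ 'm) \<Rightarrow> bool"
  where "analytic_map_on S \<phi> \<longleftrightarrow> (\<forall>j. analytic_fun_on S (\<lambda>z. \<phi> z $ j))"

definition analytic_self_map :: "(complex ^ 'n \<Rightarrow> complex ^ 'n) \<Rightarrow> bool"
  where "analytic_self_map \<phi> \<longleftrightarrow> analytic_map_on unit_ball \<phi> \<and> \<phi> ` unit_ball \<subseteq> unit_ball"

definition ball_automorphism :: "(complex ^ 'n \<Rightarrow> complex ^ 'n) \<Rightarrow> bool"
  where "ball_automorphism \<phi> \<longleftrightarrow>
    bij_betw \<phi> unit_ball unit_ball \<and> analytic_map_on unit_ball \<phi> \<and>
    analytic_map_on unit_ball (inv_into unit_ball \<phi>)"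

(* A function on X is represented by the total function that vanishes outside X, so that
   equality of representatives is equality on X. *)
definition extend0 :: "'a set \<Rightarrow> ('a \<Rightarrow> complex) \<Rightarrow> 'a \<Rightarrow> complex"
  where "extend0 X h = (\<lambda>z. if z \<in> X then h z else 0)"

definition ip_norm :: "(('a \<Rightarrow> complex) \<Rightarrow> ('a \<Rightarrow> complex) \<Rightarrow> complex) \<Rightarrow> ('a \<Rightarrow> complex) \<Rightarrow> real"
  where "ip_norm ip h = sqrt (Re (ip h h))"

(* H is the underlying set of a complex Hilbert space of functions on X; its inner product ip
   is linear in the first argument and only matters on H. *)
locale function_hilbert_space =
  fixes X :: "'a set"
    and H :: "('a \<Rightarrow> complex) set"
    and ip :: "('a \<Rightarrow> complex) \<Rightarrow> ('a \<Rightarrow> complex) \<Rightarrow> complex"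
  assumes vanish_outside: "\<And>h z. h \<in> H \<Longrightarrow> z \<notin> X \<Longrightarrow> h z = 0"
    and zero_mem: "(\<lambda>z. 0) \<in> H"
    and add_mem: "\<And>h k. h \<in> H \<Longrightarrow> k \<in> H \<Longrightarrow> (\<lambda>z. h z + k z) \<in> H"
    and scale_mem: "\<And>c h. h \<in> H \<Longrightarrow> (\<lambda>z. c * h z) \<in> H"
    and ip_add: "\<And>h k l. h \<in> H \<Longrightarrow> k \<in> H \<Longrightarrow> l \<in> H \<Longrightarrow>
          ip (\<lambda>z. h z + k z) l = ip h l + ip k l"
    and ip_scale: "\<And>c h l. h \<in> H \<Longrightarrow> l \<in> H \<Longrightarrow> ip (\<lambda>z. c * h z) l = c * ip h l"
    and ip_cnj: "\<And>h k. h \<in> H \<Longrightarrow> k \<in> H \<Longrightarrow> ip k h = cnj (ip h k)"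
    and ip_nonneg: "\<And>h. h \<in> H \<Longrightarrow> 0 \<le> Re (ip h h)"
    and ip_definite: "\<And>h. h \<in> H \<Longrightarrow> ip h h = 0 \<Longrightarrow> h = (\<lambda>z. 0)"
    and complete: "\<And>s. (\<And>i. s i \<in> H) \<Longrightarrow>
          (\<And>e. e > 0 \<Longrightarrow> \<exists>N::nat. \<forall>i\<ge>N. \<forall>j\<ge>N. ip_norm ip (\<lambda>z. s i z - s j z) < e) \<Longrightarrow>
          \<exists>h\<in>H. (\<lambda>i. ip_norm ip (\<lambda>z. s i z - h z)) \<longlonglongrightarrow> 0"

locale reproducing_kernel_space = function_hilbert_space X H ip
  for X :: "'a set" and H ip +
  fixes K :: "'a \<Rightarrow> 'a \<Rightarrow> complex"
  assumes kernel_mem: "\<And>z. z \<in> X \<Longrightarrow> extend0 X (K z) \<in> H"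
    and reproducing: "\<And>h z. h \<in> H \<Longrightarrow> z \<in> X \<Longrightarrow> h z = ip h (extend0 X (K z))"

(* The complex powr is taken with the principal branch Ln; Re (1 - cdot w z) > 0 on the ball. *)
definition ball_kernel :: "real \<Rightarrow> complex ^ 'n \<Rightarrow> complex ^ 'n \<Rightarrow> complex"
  where "ball_kernel \<gamma> z w = (1 - cdot w z) powr (- complex_of_real \<gamma>)"

definition normalized_kernel :: "real \<Rightarrow> complex ^ 'n \<Rightarrow> complex ^ 'n \<Rightarrow> complex"
  where "normalized_kernel \<gamma> a w =
    complex_of_real ((1 - (norm a)\<^sup>2) powr (\<gamma> / 2)) * ball_kernel \<gamma> a w"

(* These axioms determine (H, ip on H): the kernel functions span a dense subspace, on which
   the inner product is given by the kernel, and norm convergence implies pointwise convergence. *)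
locale H_space =
  reproducing_kernel_space "unit_ball :: (complex ^ 'n) set" H ip "ball_kernel \<gamma>"
  for \<gamma> :: real and H :: "(complex ^ 'n \<Rightarrow> complex) set" and ip +
  assumes analytic: "\<And>h. h \<in> H \<Longrightarrow> analytic_fun_on unit_ball h"

definition bounded_operator_on :: "('a \<Rightarrow> complex) set \<Rightarrow>
    (('a \<Rightarrow> complex) \<Rightarrow> ('a \<Rightarrow> complex) \<Rightarrow> complex) \<Rightarrow>
    (('a \<Rightarrow> complex) \<Rightarrow> ('a \<Rightarrow> complex)) \<Rightarrow> bool"
  where "bounded_operator_on H ip T \<longleftrightarrow>
    (\<forall>h\<in>H. T h \<in> H) \<and>
    (\<forall>h\<in>H. \<forall>k\<in>H. T (\<lambda>z. h z + k z) = (\<lambda>z. T h z + T k z)) \<and>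
    (\<forall>c. \<forall>h\<in>H. T (\<lambda>z. c * h z) = (\<lambda>z. c * T h z)) \<and>
    (\<exists>C. \<forall>h\<in>H. ip_norm ip (T h) \<le> C * ip_norm ip h)"

(* For a bounded operator T on a Hilbert space and h in H, the described element exists
   uniquely by the Riesz representation theorem. *)
definition adjoint_on :: "('a \<Rightarrow> complex) set \<Rightarrow>
    (('a \<Rightarrow> complex) \<Rightarrow> ('a \<Rightarrow> complex) \<Rightarrow> complex) \<Rightarrow>
    (('a \<Rightarrow> complex) \<Rightarrow> ('a \<Rightarrow> complex)) \<Rightarrow> ('a \<Rightarrow> complex) \<Rightarrow> ('a \<Rightarrow> complex)"
  where "adjoint_on H ip T h = (THE u. u \<in> H \<and> (\<forall>v\<in>H. ip (T v) h = ip v u))"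

definition unitary_on :: "('a \<Rightarrow> complex) set \<Rightarrow>
    (('a \<Rightarrow> complex) \<Rightarrow> ('a \<Rightarrow> complex) \<Rightarrow> complex) \<Rightarrow>
    (('a \<Rightarrow> complex) \<Rightarrow> ('a \<Rightarrow> complex)) \<Rightarrow> bool"
  where "unitary_on H ip U \<longleftrightarrow> bounded_operator_on H ip U \<and>
    (\<forall>h\<in>H. U (adjoint_on H ip U h) = h \<and> adjoint_on H ip U (U h) = h)"

definition weighted_comp :: "(complex ^ 'n \<Rightarrow> complex) \<Rightarrow> (complex ^ 'n \<Rightarrow> complex ^ 'n) \<Rightarrow>
    (complex ^ 'n \<Rightarrow> complex) \<Rightarrow> (complex ^ 'n \<Rightarrow> complex)"
  where "weighted_comp f \<phi> h = extend0 unit_ball (\<lambda>z. f z * h (\<phi> z))"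

end

theory Submission
  imports Defs "HOL-Complex_Analysis.Conformal_Mappings"
begin

text \<open>Since the adjoint of \<open>W\<^bsub>g,\<psi>\<^esub>\<close> sends the kernel \<open>K\<^sub>w\<close> to the multiple \<open>cnj (g w)\<close> of
  \<open>K\<^bsub>\<psi> w\<^esub>\<close>, the operator identity amounts to
  \<open>f z * cnj (g w) * (1 - \<langle>\<phi> z, \<psi> w\<rangle>) powr -\<gamma> = (1 - \<langle>z, w\<rangle>) powr -\<gamma>\<close>.
  Dividing by the instances with \<open>z = 0\<close> or \<open>w = 0\<close> removes \<open>f\<close> and \<open>g\<close>, and a connectedness argument
  removes the exponent. On the diagonal the result shows that \<open>\<langle>\<phi> z, \<psi> z\<rangle> \<rightarrow> 1\<close> at the sphere,
  so \<open>\<phi> = \<psi>\<close> by the maximum principle. Composing \<open>\<phi>\<close> with the involution exchanging \<open>0\<close> and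
  \<open>\<phi> 0\<close> then gives a map that preserves \<open>\<langle>z, w\<rangle>\<close>, i.e. a unitary one, so \<open>\<phi>\<close> is an
  automorphism; \<open>w = a\<close> yields \<open>f\<close> and \<open>g\<close>. Conversely, the Schwarz lemma shows that an automorphism
  differs from such an involution by a unitary map, which gives back the kernel identity.\<close>

section \<open>The Hermitian inner product\<close>

lemma cdot_linear [simp]:
  "cdot (x + y) w = cdot x w + cdot y w"
  "cdot (x - y) w = cdot x w - cdot y w"
  "cdot w (x + y) = cdot w x + cdot w y"
  "cdot w (x - y) = cdot w x - cdot w y"
  "cdot (c *s x) w = c * cdot x w"
  "cdot w (c *s x) = cnj c * cdot w x"
  "cdot 0 w = 0" "cdot w 0 = 0"
  by (simp_all add: cdot_def sum.distrib sum_subtractf algebra_simps sum_distrib_left)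

lemma cnj_cdot [simp]: "cnj (cdot z w) = cdot w z"
  by (simp add: cdot_def mult.commute)

lemma cdot_self: "cdot z z = of_real ((norm z)\<^sup>2)"
proof -
  have "(norm z)\<^sup>2 = (\<Sum>j\<in>UNIV. (cmod (z $ j))\<^sup>2)"
    by (simp add: norm_vec_def L2_set_def sum_nonneg)
  then show ?thesis
    by (simp only: cdot_def of_real_sum complex_norm_square)
qed

lemma Re_cdot: "Re (cdot z w) = z \<bullet> w"
  by (simp add: cdot_def inner_vec_def inner_complex_def)

text \<open>This form lets invariance of the real inner product under a map commuting with complex
  scalars carry over to \<open>cdot\<close>.\<close>

lemma Im_cdot: "Im (cdot z w) = Re (cdot ((- \<i>) *s z) w)"
  by (simp only: cdot_linear) simp

lemma norm_vector_scale: "norm (c *s z) = cmod c * norm (z :: complex ^ 'n)"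
  by (simp add: norm_vec_def L2_set_def norm_mult power_mult_distrib real_sqrt_mult
      flip: sum_distrib_left)

lemma of_real_vector_scale: "complex_of_real r *s z = r *\<^sub>R z"
  by (simp add: vec_eq_iff scaleR_conv_of_real [where 'a = complex])

text \<open>A factor of modulus at most 1 rotates \<open>cdot z w\<close> onto the nonnegative real
  axis, where the real Cauchy-Schwarz inequality applies.\<close>

lemma norm_cdot_le: "cmod (cdot z w) \<le> norm z * norm w"
proof -
  let ?u = "cnj (sgn (cdot z w))"
  have "of_real (cmod (cdot z w)) = cdot (?u *s z) w"
    by (simp add: sgn_eq mult.commute complex_norm_square [symmetric] power2_eq_square del: cnj_cdot)
  then have "cmod (cdot z w) = (?u *s z) \<bullet> w"
    by (metis Re_complex_of_real Re_cdot)
  also have "\<dots> \<le> norm (?u *s z) * norm w" by (rule norm_cauchy_schwarz)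
  also have "\<dots> = cmod ?u * (norm z * norm w)" by (simp add: norm_vector_scale)
  also have "\<dots> \<le> 1 * (norm z * norm w)"
    by (rule mult_right_mono) (auto simp: norm_sgn)
  finally show ?thesis by simp
qed

lemma norm_cdot_less_1: "cmod (cdot z w) < 1" if "z \<in> unit_ball" "w \<in> unit_ball"
proof -
  have "norm z * norm w \<le> norm z * 1" using that by (intro mult_left_mono) auto
  then show ?thesis using norm_cdot_le [of z w] that by simp
qed

text \<open>Keeps \<open>1 - cdot z w\<close> off the branch cut of \<open>Ln\<close> and its
  argument below \<pi>/2 in modulus.\<close>

lemma Re_one_minus_cdot: "0 < Re (1 - cdot z w)" if "z \<in> unit_ball" "w \<in> unit_ball"
  using norm_cdot_less_1 [OF that] abs_Re_le_cmod [of "cdot z w"] by simp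

lemma one_minus_cdot_nz: "1 - cdot z w \<noteq> 0" if "z \<in> unit_ball" "w \<in> unit_ball"
  using Re_one_minus_cdot [OF that] by auto

lemma cdot_left_cancel: "x = y" if eq: "\<And>w. w \<in> unit_ball \<Longrightarrow> cdot x w = cdot y w"
proof -
  \<comment> \<open>The test vector is \<open>x - y\<close>, shrunk by \<open>r\<close> into the
    ball; the added 1 keeps the denominator nonzero when \<open>x = y\<close>.\<close>
  define r where "r = 1 / (2 * (norm (x - y) + 1))"
  have "r > 0" by (simp add: r_def add_nonneg_pos)
  have "norm (of_real r *s (x - y)) = norm (x - y) / (2 * (norm (x - y) + 1))"
    using \<open>r > 0\<close> by (simp only: norm_vector_scale norm_of_real) (simp add: r_def)
  also have "\<dots> < 1" by (simp add: divide_simps add_nonneg_pos)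
  finally have "cdot x (of_real r *s (x - y)) = cdot y (of_real r *s (x - y))"
    by (intro eq) simp
  then have "of_real r * cdot (x - y) (x - y) = 0"
    by (metis cdot_linear(2,6) complex_cnj_complex_of_real diff_self)
  then show ?thesis using \<open>r > 0\<close> by (simp add: cdot_self del: cdot_linear)
qed

section \<open>Analytic maps\<close>

lemma linear_cdot_left: "bounded_linear (\<lambda>z. cdot z b)"
proof
  show "cdot (x + y) b = cdot x b + cdot y b" for x y by simp
  show "cdot (r *\<^sub>R x) b = r *\<^sub>R cdot x b" for r x
    by (simp only: of_real_vector_scale [symmetric] cdot_linear scaleR_conv_of_real)
  show "\<exists>K. \<forall>x. norm (cdot x b) \<le> norm x * K"
    using norm_cdot_le by blast
qed

text \<open>Assembling the component derivatives along the coordinate axes gives a single complex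
  linear derivative, which is the form that the chain rule needs.\<close>

lemma analytic_map_on_iff:
  "analytic_map_on S \<phi> \<longleftrightarrow>
    (\<forall>z\<in>S. \<exists>D. (\<phi> has_derivative D) (at z) \<and> (\<forall>c v. D (c *s v) = c *s D v))"
proof
  assume *: "analytic_map_on S \<phi>"
  show "\<forall>z\<in>S. \<exists>D. (\<phi> has_derivative D) (at z) \<and> (\<forall>c v. D (c *s v) = c *s D v)"
  proof
    fix z assume "z \<in> S"
    then have "\<forall>j. \<exists>D. ((\<lambda>z. \<phi> z $ j) has_derivative D) (at z) \<and> (\<forall>c v. D (c *s v) = c * D v)"
      using * by (auto simp: analytic_map_on_def analytic_fun_on_def)
    from choice [OF this] obtain D where D: "\<And>j. ((\<lambda>z. \<phi> z $ j) has_derivative D j) (at z)"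
      and lin: "\<And>j c v. D j (c *s v) = c * D j v"
      by blast
    have bl: "bounded_linear (axis j :: complex \<Rightarrow> complex ^ 'b)" for j
      by (intro linear_conv_bounded_linear [THEN iffD1] linearI)
         (auto simp: vec_eq_iff axis_def)
    have eq: "v = (\<Sum>j\<in>UNIV. axis j (v $ j))" for v :: "complex ^ 'b"
      by (simp add: vec_eq_iff axis_def if_distrib sum.delta cong: if_cong)
    have "((\<lambda>z. \<Sum>j\<in>UNIV. axis j (\<phi> z $ j)) has_derivative (\<lambda>v. \<Sum>j\<in>UNIV. axis j (D j v))) (at z)"
      by (rule has_derivative_sum) (rule bounded_linear.has_derivative [OF bl D])
    then have "(\<phi> has_derivative (\<lambda>v. \<Sum>j\<in>UNIV. axis j (D j v))) (at z)"
      unfolding eq [symmetric] .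
    moreover have "(\<Sum>j\<in>UNIV. axis j (D j (c *s v))) = c *s (\<Sum>j\<in>UNIV. axis j (D j v))" for c v
      by (simp add: vec_eq_iff axis_def lin if_distrib sum.delta cong: if_cong)
    ultimately show "\<exists>D. (\<phi> has_derivative D) (at z) \<and> (\<forall>c v. D (c *s v) = c *s D v)" by blast
  qed
next
  assume *: "\<forall>z\<in>S. \<exists>D. (\<phi> has_derivative D) (at z) \<and> (\<forall>c v. D (c *s v) = c *s D v)"
  show "analytic_map_on S \<phi>"
    unfolding analytic_map_on_def analytic_fun_on_def
  proof (intro allI ballI)
    fix j z assume "z \<in> S"
    with * obtain D where D: "(\<phi> has_derivative D) (at z)" "\<forall>c v. D (c *s v) = c *s D v" by blast
    then show "\<exists>D. ((\<lambda>z. \<phi> z $ j) has_derivative D) (at z) \<and> (\<forall>c v. D (c *s v) = c * D v)"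
      using bounded_linear.has_derivative [OF bounded_linear_vec_nth D(1), of j]
      by (intro exI [of _ "\<lambda>v. D v $ j"]) auto
  qed
qed

lemma analytic_map_on_compose:
  assumes "analytic_map_on S \<phi>" "analytic_map_on T \<psi>" "\<phi> ` S \<subseteq> T"
  shows "analytic_map_on S (\<lambda>z. \<psi> (\<phi> z))"
  unfolding analytic_map_on_iff
proof
  fix z assume "z \<in> S"
  then obtain D E where D: "(\<phi> has_derivative D) (at z)" "\<forall>c v. D (c *s v) = c *s D v"
    and E: "(\<psi> has_derivative E) (at (\<phi> z))" "\<forall>c v. E (c *s v) = c *s E v"
    using assms unfolding analytic_map_on_iff by blast
  have "((\<lambda>z. \<psi> (\<phi> z)) has_derivative (\<lambda>v. E (D v))) (at z)"
    using D(1) E(1) by (rule has_derivative_compose)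
  with D(2) E(2) show "\<exists>D. ((\<lambda>z. \<psi> (\<phi> z)) has_derivative D) (at z) \<and> (\<forall>c v. D (c *s v) = c *s D v)"
    by (intro exI [of _ "\<lambda>v. E (D v)"]) auto
qed

lemma analytic_map_on_cong:
  assumes "analytic_map_on S \<phi>" "open S" "\<And>z. z \<in> S \<Longrightarrow> \<psi> z = \<phi> z"
  shows "analytic_map_on S \<psi>"
  unfolding analytic_map_on_iff
proof
  fix z assume "z \<in> S"
  then obtain D where "(\<phi> has_derivative D) (at z)" "\<forall>c v. D (c *s v) = c *s D v"
    using assms(1) unfolding analytic_map_on_iff by blast
  then show "\<exists>D. (\<psi> has_derivative D) (at z) \<and> (\<forall>c v. D (c *s v) = c *s D v)"
    using has_derivative_transform_within_open [of \<phi> D z UNIV S \<psi>] \<open>z \<in> S\<close> assms by metis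
qed

lemma analytic_map_on_continuous: "analytic_map_on S \<phi> \<Longrightarrow> continuous_on S \<phi>"
  unfolding analytic_map_on_iff
  by (meson continuous_at_imp_continuous_on has_derivative_continuous)

text \<open>Complex linearity of \<open>D\<close> turns the real derivative along a complex line
  into multiplication by a complex number; this opens the way to one-variable theorems.\<close>

lemma analytic_slice:
  assumes D: "(\<phi> has_derivative D) (at (\<zeta> *s u))" "\<forall>c v. D (c *s v) = c *s D v"
  shows "((\<lambda>\<zeta>. cdot (\<phi> (\<zeta> *s u)) w) has_field_derivative cdot (D u) w) (at \<zeta>)"
proof -
  have "bounded_linear (\<lambda>\<zeta>. \<zeta> *s u)"
    by (intro linear_conv_bounded_linear [THEN iffD1] linearI)
       (auto simp: vec_eq_iff algebra_simps)
  then have "((\<lambda>\<zeta>. \<zeta> *s u) has_derivative (\<lambda>\<zeta>. \<zeta> *s u)) (at \<zeta>)"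
    by (rule bounded_linear_imp_has_derivative)
  then have "((\<lambda>\<zeta>. \<phi> (\<zeta> *s u)) has_derivative (\<lambda>\<zeta>. D (\<zeta> *s u))) (at \<zeta>)"
    by (rule has_derivative_compose) (rule D)
  from bounded_linear.has_derivative [OF linear_cdot_left this, of w]
  have "((\<lambda>\<zeta>. cdot (\<phi> (\<zeta> *s u)) w) has_derivative (\<lambda>v. cdot (D (v *s u)) w)) (at \<zeta>)" .
  moreover have "(\<lambda>v. cdot (D (v *s u)) w) = (*) (cdot (D u) w)"
    using D(2) by (auto simp: mult.commute)
  ultimately show ?thesis unfolding has_field_derivative_def by simp
qed

lemma holomorphic_slice:
  assumes "analytic_map_on unit_ball \<phi>" "norm u \<le> 1"
  shows "(\<lambda>\<zeta>. cdot (\<phi> (\<zeta> *s u)) w) holomorphic_on ball 0 1"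
proof -
  have "\<exists>c. ((\<lambda>\<zeta>. cdot (\<phi> (\<zeta> *s u)) w) has_field_derivative c) (at \<zeta>)"
    if "\<zeta> \<in> ball 0 1" for \<zeta>
  proof -
    have "cmod \<zeta> * norm u \<le> cmod \<zeta>"
      using assms(2) by (simp add: mult_left_le)
    then have "\<zeta> *s u \<in> unit_ball"
      using that by (simp add: norm_vector_scale)
    then obtain D where "(\<phi> has_derivative D) (at (\<zeta> *s u))" "\<forall>c v. D (c *s v) = c *s D v"
      using assms(1) unfolding analytic_map_on_iff by blast
    then show ?thesis using analytic_slice by blast
  qed
  then show ?thesis by (simp add: holomorphic_on_open)
qed

section \<open>Automorphisms of the ball\<close>

text \<open>The automorphism of the ball that exchanges \<open>0\<close> and \<open>b\<close>, usually written as
  \<open>(b - P z - s Q z) / (1 - \<langle>z, b\<rangle>)\<close> with \<open>P\<close> the orthogonal projection onto the span of \<open>b\<close>,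
  \<open>Q = I - P\<close> and \<open>s\<^sup>2 = 1 - |b|\<^sup>2\<close>. Since \<open>(1 - s) / |b|\<^sup>2 = 1 / (1 + s)\<close>, the following form also
  covers \<open>b = 0\<close>.\<close>

definition ball_involution :: "complex ^ 'n \<Rightarrow> complex ^ 'n \<Rightarrow> complex ^ 'n"
  where "ball_involution b z =
    (let s = complex_of_real (sqrt (1 - (norm b)\<^sup>2)) in
      (1 / (1 - cdot z b)) *s (b - s *s z - (cdot z b / (1 + s)) *s b))"

text \<open>Replaces the square root and the quotient by scalars with polynomial relations, so that
  later identities become ring algebra.\<close>

lemma ball_involution_eq:
  assumes "b \<in> unit_ball"
  obtains s t where "\<And>z. ball_involution b z = (1 / (1 - cdot z b)) *s (b - s *s z - (t * cdot z b) *s b)"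
    and "t * (1 + s) = 1" "cdot b b = 1 - s * s" "cnj s = s" "cnj t = t" "s \<noteq> 0"
proof -
  define r where "r = sqrt (1 - (norm b)\<^sup>2)"
  have lt: "(norm b)\<^sup>2 < 1" using assms by (simp add: power_less_one_iff abs_square_less_1)
  then have "r > 0" "r * r = 1 - (norm b)\<^sup>2" by (simp_all add: r_def)
  then have nz: "1 + complex_of_real r \<noteq> 0"
    by (metis add_pos_pos less_numeral_extra(1,3) of_real_1 of_real_add of_real_eq_0_iff)
  show thesis
  proof
    show "ball_involution b z = (1 / (1 - cdot z b)) *s
        (b - of_real r *s z - (1 / (1 + of_real r) * cdot z b) *s b)" for z
      by (simp add: ball_involution_def Let_def r_def)
    show "1 / (1 + of_real r) * (1 + complex_of_real r) = 1" using nz by simp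
    show "cdot b b = 1 - complex_of_real r * of_real r"
      using \<open>r * r = 1 - (norm b)\<^sup>2\<close> by (simp add: cdot_self flip: of_real_mult)
  qed (use \<open>r > 0\<close> in auto)
qed

lemma ball_involution_cdot:
  assumes "b \<in> unit_ball" "z \<in> unit_ball" "w \<in> unit_ball"
  shows "(1 - cdot (ball_involution b z) (ball_involution b w)) * ((1 - cdot z b) * (1 - cdot b w)) =
    (1 - cdot b b) * (1 - cdot z w)"
proof -
  obtain s t where e: "\<And>z. ball_involution b z = (1 / (1 - cdot z b)) *s (b - s *s z - (t * cdot z b) *s b)"
    and t: "t * (1 + s) = 1" and B: "cdot b b = 1 - s * s" and [simp]: "cnj s = s" "cnj t = t" and "s \<noteq> 0"
    using ball_involution_eq [OF assms(1)] by metis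
  define N where "N z = b - s *s z - (t * cdot z b) *s b" for z
  have N: "cdot (N z) (N w) = cdot b b - cdot z b - cdot b w + cdot z b * cdot b w + s * s * cdot z w"
  proof -
    have "cdot (N z) (N w) = cdot b b - s * cdot b w - t * cdot b w * cdot b b
       - s * (cdot z b - s * cdot z w - t * cdot b w * cdot z b)
       - t * cdot z b * (cdot b b - s * cdot b w - t * cdot b w * cdot b b)"
      by (simp add: N_def algebra_simps)
    \<comment> \<open>The relations give \<open>t * cdot b b = 1 - s\<close>, which together with
      \<open>t * (1 + s) = 1\<close> removes \<open>t\<close>.\<close>
    then show ?thesis using t B by algebra
  qed
  have "cdot (ball_involution b z) (ball_involution b w) =
      1 / (1 - cdot z b) * (1 / (1 - cdot b w)) * cdot (N z) (N w)"
    by (simp add: e flip: N_def)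
  then have "cdot (ball_involution b z) (ball_involution b w) * ((1 - cdot z b) * (1 - cdot b w)) =
      cdot (N z) (N w)"
    using one_minus_cdot_nz [OF assms(2,1)] one_minus_cdot_nz [OF assms(1,3)] by simp
  then show ?thesis
    by (simp add: N B algebra_simps)
qed

text \<open>On the diagonal, the identity for \<open>cdot\<close> shows that
  \<open>1 - (norm (ball_involution b z))\<^sup>2\<close> times a positive square is a positive
  number.\<close>

lemma ball_involution_in_ball:
  assumes "b \<in> unit_ball" "z \<in> unit_ball"
  shows "ball_involution b z \<in> unit_ball"
proof -
  let ?q = "1 - cdot z b"
  have nz: "?q \<noteq> 0" using assms by (intro one_minus_cdot_nz)
  have "?q * (1 - cdot b z) = of_real ((cmod ?q)\<^sup>2)"
    by (simp only: complex_norm_square) simp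
  with ball_involution_cdot [OF assms assms(2)]
  have "complex_of_real ((1 - (norm (ball_involution b z))\<^sup>2) * (cmod ?q)\<^sup>2) =
     of_real ((1 - (norm b)\<^sup>2) * (1 - (norm z)\<^sup>2))"
    by (simp only: cdot_self of_real_mult of_real_diff of_real_1)
  then have "(1 - (norm (ball_involution b z))\<^sup>2) * (cmod ?q)\<^sup>2 =
     (1 - (norm b)\<^sup>2) * (1 - (norm z)\<^sup>2)"
    by (simp only: of_real_eq_iff)
  moreover have "\<dots> > 0" using assms by (simp add: abs_square_less_1)
  ultimately have "1 - (norm (ball_involution b z))\<^sup>2 > 0"
    by (metis zero_less_mult_pos2 nz zero_less_norm_iff zero_less_power)
  then show ?thesis by (simp add: abs_square_less_1)
qed

lemma ball_involution_involutive:
  assumes "b \<in> unit_ball" "z \<in> unit_ball"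
  shows "ball_involution b (ball_involution b z) = z"
proof -
  obtain s t where e: "\<And>z. ball_involution b z = (1 / (1 - cdot z b)) *s (b - s *s z - (t * cdot z b) *s b)"
    and t: "t * (1 + s) = 1" and B: "cdot b b = 1 - s * s" and "s \<noteq> 0"
    using ball_involution_eq [OF assms(1)] by metis
  define x where "x = cdot z b"
  define c where "c = cdot (ball_involution b z) b"
  have nz: "1 - x \<noteq> 0" unfolding x_def using assms by (intro one_minus_cdot_nz)
  have "c = 1 / (1 - x) * (cdot b b - s * x - t * x * cdot b b)"
    by (simp add: e x_def c_def diff_divide_distrib)
  then have "(1 - x) * c = cdot b b - s * x - t * x * cdot b b" using nz by simp
  then have c: "(1 - x) * c = cdot b b - x" using t B by algebra
  \<comment> \<open>The denominators of the two successive applications multiply to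
    \<open>s * s\<close>, so the second one is nonzero as well.\<close>
  then have c1: "(1 - x) * (1 - c) = s * s" by (simp add: B algebra_simps)
  then have nzc: "1 - c \<noteq> 0" using \<open>s \<noteq> 0\<close> by auto
  show ?thesis
  proof (simp add: vec_eq_iff, rule allI)
    fix j
    have "(1 - x) * ball_involution b z $ j = b $ j - s * z $ j - t * x * b $ j"
      using nz by (simp add: e [of z] flip: x_def diff_divide_distrib)
    with c c1 t B have "(1 - x) * (b $ j - s * ball_involution b z $ j - t * c * b $ j) =
        (1 - x) * ((1 - c) * z $ j)"
      by algebra
    then have "b $ j - s * ball_involution b z $ j - t * c * b $ j = (1 - c) * z $ j"
      using nz by simp
    then show "ball_involution b (ball_involution b z) $ j = z $ j"
      using nzc by (simp add: e [of "ball_involution b z"] flip: c_def diff_divide_distrib)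
  qed
qed

lemma ball_involution_0 [simp]: "ball_involution b 0 = b"
  by (simp add: ball_involution_def)

lemma ball_involution_self: "b \<in> unit_ball \<Longrightarrow> ball_involution b b = 0"
  using ball_involution_involutive [of b 0] by simp

lemma analytic_ball_involution:
  assumes "b \<in> unit_ball"
  shows "analytic_map_on unit_ball (ball_involution b)"
  unfolding analytic_map_on_def analytic_fun_on_def
proof (intro allI ballI)
  fix j and z :: "complex ^ 'a" assume z: "z \<in> unit_ball"
  obtain s t where e: "\<And>z. ball_involution b z = (1 / (1 - cdot z b)) *s (b - s *s z - (t * cdot z b) *s b)"
    using ball_involution_eq [OF assms(1)] by metis
  note [derivative_intros] = bounded_linear.has_derivative [OF linear_cdot_left]
    bounded_linear.has_derivative [OF bounded_linear_vec_nth]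
  define g where "g z = b $ j - s * z $ j - (t * cdot z b) * b $ j" for z
  define g' where "g' v = - (s * v $ j) - (t * cdot v b) * b $ j" for v
  have "(g has_derivative g') (at z)"
    unfolding g_def g'_def by (auto intro!: derivative_eq_intros)
  moreover have "((\<lambda>z. 1 - cdot z b) has_derivative (\<lambda>v. - cdot v b)) (at z)"
    by (auto intro!: derivative_eq_intros)
  ultimately have "((\<lambda>z. g z / (1 - cdot z b)) has_derivative
      (\<lambda>v. (g' v * (1 - cdot z b) - g z * (- cdot v b)) / ((1 - cdot z b) * (1 - cdot z b)))) (at z)"
    using one_minus_cdot_nz [OF z assms] by (rule has_derivative_divide')
  moreover have "(\<lambda>z. ball_involution b z $ j) = (\<lambda>z. g z / (1 - cdot z b))"
    by (simp add: e g_def fun_eq_iff diff_divide_distrib)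
  ultimately show "\<exists>D. ((\<lambda>z. ball_involution b z $ j) has_derivative D) (at z) \<and>
      (\<forall>c v. D (c *s v) = c * D v)"
    by (intro exI [of _ "\<lambda>v. (g' v * (1 - cdot z b) - g z * (- cdot v b)) / ((1 - cdot z b) * (1 - cdot z b))"])
       (simp add: g'_def algebra_simps divide_simps)
qed

section \<open>Unitary maps and the automorphisms they generate\<close>

text \<open>Preserving \<open>cdot\<close> forces linearity: the squared norm of
  \<open>V (z + w) - (V z + V w)\<close> expands into values of \<open>cdot\<close>, so it equals
  that of \<open>z + w - (z + w)\<close>. Extending by homogeneity first makes all sums
  available.\<close>

lemma cdot_preserving_extends:
  fixes U :: "complex ^ 'n \<Rightarrow> complex ^ 'n"
  assumes U: "\<And>z w. z \<in> unit_ball \<Longrightarrow> w \<in> unit_ball \<Longrightarrow> cdot (U z) (U w) = cdot z w"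
  obtains V where "\<And>z. z \<in> unit_ball \<Longrightarrow> U z = V z" "linear V" "bij V"
    "\<And>c z. V (c *s z) = c *s V z" "\<And>z w. cdot (V z) (V w) = cdot z w"
proof -
  \<comment> \<open>For \<open>z \<noteq> 0\<close> this is the point of norm 1/2 on the ray of
    \<open>z\<close>. As division by 0 gives 0, \<open>p 0 = 0\<close> and no case split
    arises.\<close>
  define p where "p z = complex_of_real (1 / (2 * norm z)) *s z" for z :: "complex ^ 'n"
  define V where "V z = complex_of_real (2 * norm z) *s U (p z)" for z
  have p_ball: "p z \<in> unit_ball" for z
    by (simp add: p_def norm_vector_scale norm_divide norm_mult)
  have p_scale: "complex_of_real (2 * norm z) *s p z = z" for z
    by (simp add: p_def)
  have V_cdot [simp]: "cdot (V z) (V w) = cdot z w" for z w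
  proof -
    have "cdot (V z) (V w) = cdot (complex_of_real (2 * norm z) *s p z) (complex_of_real (2 * norm w) *s p w)"
      by (simp add: V_def U [OF p_ball p_ball])
    then show ?thesis unfolding p_scale .
  qed
  have eqI: "x = y" if "cdot (x - y) (x - y) = 0" for x y :: "complex ^ 'n"
    using that by (simp add: cdot_self del: cdot_linear)
  have add: "V (z + w) = V z + V w" for z w
    by (rule eqI) (simp add: algebra_simps)
  have scale: "V (c *s z) = c *s V z" for c z
    by (rule eqI) (simp add: algebra_simps)
  have lin: "linear V"
    using scale [of "of_real r" for r] by (intro linearI add) (simp add: of_real_vector_scale)
  have UV: "U z = V z" if "z \<in> unit_ball" for z
  proof -
    have "cdot (U z) (V z) = cdot z (complex_of_real (2 * norm z) *s p z)"
      by (simp add: V_def U [OF that p_ball])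
    moreover have "cdot (V z) (U z) = cdot (complex_of_real (2 * norm z) *s p z) z"
      by (simp add: V_def U [OF p_ball that])
    ultimately show ?thesis unfolding p_scale by (intro eqI) (simp add: U [OF that that])
  qed
  have "inj V"
  proof (rule injI)
    fix z w assume "V z = V w"
    then have "cdot (V z) (V v) = cdot (V w) (V v)" for v by simp
    then show "z = w" by (intro eqI) simp
  qed
  with lin have "bij V" by (simp add: bij_def linear_injective_imp_surjective)
  then show thesis using that UV lin scale V_cdot by blast
qed

text \<open>The composite with the involution extends to a unitary \<open>V\<close>, so on the ball
  \<phi> is \<open>V\<close> followed by \<open>ball_involution b\<close>, and
  \<open>ball_involution b\<close> followed by \<open>inv V\<close> is an analytic inverse.\<close>

lemma ball_automorphism_if_cdot_preserving:
  fixes \<phi> :: "complex ^ 'n \<Rightarrow> complex ^ 'n"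
  assumes \<phi>: "analytic_self_map \<phi>" and b: "b \<in> unit_ball"
    and U: "\<And>z w. z \<in> unit_ball \<Longrightarrow> w \<in> unit_ball \<Longrightarrow>
      cdot (ball_involution b (\<phi> z)) (ball_involution b (\<phi> w)) = cdot z w"
  shows "ball_automorphism \<phi>"
proof -
  obtain V where V: "\<And>z. z \<in> unit_ball \<Longrightarrow> ball_involution b (\<phi> z) = V z" "linear V" "bij V"
    "\<And>c z. V (c *s z) = c *s V z" "\<And>z w. cdot (V z) (V w) = cdot z w"
    using cdot_preserving_extends [of "\<lambda>z. ball_involution b (\<phi> z)"] U by metis
  define V' where "V' = inv V"
  have V'V: "V' (V z) = z" and VV': "V (V' z) = z" for z
    using V(3) by (simp_all add: V'_def bij_is_inj bij_is_surj surj_f_inv_f)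
  have V'_ball: "V' z \<in> unit_ball" if "z \<in> unit_ball" for z
  proof -
    have "complex_of_real ((norm (V' z))\<^sup>2) = of_real ((norm z)\<^sup>2)"
      using V(5) [of "V' z" "V' z"] unfolding cdot_self VV' by simp
    then have "(norm (V' z))\<^sup>2 = (norm z)\<^sup>2" by (simp only: of_real_eq_iff)
    with that show ?thesis by simp
  qed
  have "linear V'"
  proof (rule linearI)
    show "V' (x + y) = V' x + V' y" for x y
      using linear_add [OF V(2), of "V' x" "V' y"] V'V [of "V' x + V' y"] by (simp add: VV')
    show "V' (r *\<^sub>R x) = r *\<^sub>R V' x" for r x
      using linear_scale [OF V(2), of r "V' x"] V'V [of "r *\<^sub>R V' x"] by (simp add: VV')
  qed
  then have "(V' has_derivative V') (at z)" for z
    by (simp add: bounded_linear_imp_has_derivative linear_conv_bounded_linear)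
  moreover have "V' (c *s z) = c *s V' z" for c z
    using V(4) [of c "V' z"] V'V [of "c *s V' z"] by (simp add: VV')
  ultimately have V'_an: "analytic_map_on UNIV V'"
    unfolding analytic_map_on_iff by blast
  define \<theta> where "\<theta> z = V' (ball_involution b z)" for z
  have \<phi>_ball: "\<phi> z \<in> unit_ball" if "z \<in> unit_ball" for z
    using \<phi> that unfolding analytic_self_map_def by blast
  have \<theta>_ball: "\<theta> z \<in> unit_ball" if "z \<in> unit_ball" for z
    unfolding \<theta>_def by (intro V'_ball ball_involution_in_ball b that)
  have \<theta>\<phi>: "\<theta> (\<phi> z) = z" if "z \<in> unit_ball" for z
    by (simp add: \<theta>_def V(1) [OF that] V'V)
  have \<phi>\<theta>: "\<phi> (\<theta> z) = z" if "z \<in> unit_ball" for z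
  proof -
    have "ball_involution b (\<phi> (\<theta> z)) = ball_involution b z"
      using V(1) [OF \<theta>_ball [OF that]] by (simp add: \<theta>_def VV')
    then show ?thesis
      using ball_involution_involutive [OF b] \<phi>_ball [OF \<theta>_ball [OF that]] that by metis
  qed
  have bij: "bij_betw \<phi> unit_ball unit_ball"
    by (rule bij_betw_byWitness [of _ \<theta>]) (use \<theta>\<phi> \<phi>\<theta> \<phi>_ball \<theta>_ball in auto)
  have "inv_into unit_ball \<phi> z = \<theta> z" if "z \<in> unit_ball" for z
    using bij \<phi>\<theta> [OF that] \<theta>_ball [OF that] by (intro inv_into_f_eq) (auto simp: bij_betw_def)
  moreover have "analytic_map_on unit_ball \<theta>"
    unfolding \<theta>_def
    by (rule analytic_map_on_compose [OF analytic_ball_involution [OF b] V'_an]) simp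
  ultimately have "analytic_map_on unit_ball (inv_into unit_ball \<phi>)"
    by (metis analytic_map_on_cong open_ball)
  with \<phi> bij show ?thesis by (simp add: ball_automorphism_def analytic_self_map_def)
qed

section \<open>The Schwarz lemma on the ball and the form of a general automorphism\<close>

lemma norm_le_of_cdot_le:
  assumes "r \<ge> 0" and "\<And>u. norm u = 1 \<Longrightarrow> cmod (cdot x u) \<le> r"
  shows "norm x \<le> r"
proof (cases "x = 0")
  case False
  define u where "u = complex_of_real (1 / norm x) *s x"
  have "norm u = 1" using False by (simp add: u_def norm_vector_scale norm_divide)
  have "cdot x u = of_real (1 / norm x) * cdot x x" by (simp add: u_def)
  also have "\<dots> = of_real (norm x)" using False by (simp add: cdot_self power2_eq_square)
  finally show ?thesis using assms(2) [OF \<open>norm u = 1\<close>] by simp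
qed (use assms in simp)

lemma unit_vector_decomposition:
  fixes z :: "complex ^ 'n"
  obtains u where "norm u = 1" "z = of_real (norm z) *s u"
proof (cases "z = 0")
  case True
  obtain u :: "complex ^ 'n" where "norm u = 1" using vector_choose_size [of 1] by auto
  then show thesis using that True by simp
next
  case False
  show thesis
    by (rule that [of "of_real (1 / norm z) *s z"])
       (use False in \<open>simp_all add: norm_vector_scale norm_divide\<close>)
qed

text \<open>Pairing with unit vectors and restricting to the complex line through \<open>z\<close>
  reduces the claim to one variable.\<close>

lemma Schwarz_ball:
  assumes U: "analytic_self_map U" "U 0 = 0" and z: "z \<in> unit_ball"
  shows "norm (U z) \<le> norm z"
proof (rule norm_le_of_cdot_le)
  fix w :: "complex ^ 'a" assume w: "norm w = 1"
  obtain u where u: "norm u = 1" "z = of_real (norm z) *s u" by (rule unit_vector_decomposition)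
  let ?h = "\<lambda>\<zeta>. cdot (U (\<zeta> *s u)) w"
  have "cmod (?h (of_real (norm z))) \<le> cmod (of_real (norm z))"
  proof (rule Schwarz_Lemma(1))
    show "?h holomorphic_on ball 0 1"
      using U u by (intro holomorphic_slice) (auto simp: analytic_self_map_def)
    show "cmod (?h \<zeta>) < 1" if "cmod \<zeta> < 1" for \<zeta>
    proof -
      have "U (\<zeta> *s u) \<in> unit_ball"
        using U that u by (auto simp: analytic_self_map_def norm_vector_scale image_subset_iff)
      then show ?thesis using norm_cdot_le [of "U (\<zeta> *s u)" w] w by simp
    qed
  qed (use U z in auto)
  then show "cmod (cdot (U z) w) \<le> norm z" using u by simp
qed simp

text \<open>The equality case of the one-variable Schwarz lemma, applied to
  \<open>\<langle>U (\<zeta> u), U'(0) u\<rangle>\<close>, makes \<open>U\<close> equal to its derivative at \<open>0\<close>.\<close>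

lemma norm_preserving_imp_cdot_preserving:
  assumes U: "analytic_map_on unit_ball U" and norm_U: "\<And>z. z \<in> unit_ball \<Longrightarrow> norm (U z) = norm z"
    and "z \<in> unit_ball" "w \<in> unit_ball"
  shows "cdot (U z) (U w) = cdot z w"
proof -
  obtain D where D: "(U has_derivative D) (at 0)" "\<And>c v. D (c *s v) = c *s D v"
    using U unfolding analytic_map_on_iff by fastforce
  interpret D: linear D using D(1) by (rule has_derivative_linear)
  have U0: "U 0 = 0" using norm_U [of 0] by simp
  have norm_D1: "norm (D u) = 1" if u: "norm u = 1" for u
  proof -
    \<comment> \<open>At a short multiple \<open>y\<close> of \<open>u\<close>, \<open>U y\<close>
      and \<open>D y\<close> differ by at most \<open>e * norm y\<close>, while
      \<open>norm (U y) = norm y\<close>; dividing by the length of \<open>y\<close> leaves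
      \<open>e\<close>.\<close>
    have "\<bar>1 - norm (D u)\<bar> \<le> e" if e: "e > 0" for e
    proof -
      obtain d where d: "d > 0" "\<And>y. norm y < d \<Longrightarrow> norm (U y - D y) \<le> e * norm y"
        using D(1) e U0 unfolding has_derivative_at_alt by (metis diff_zero)
      define t where "t = min (1/2) (d / 2)"
      have t: "t > 0" "t < 1" "t < d" using d by (auto simp: t_def)
      let ?y = "complex_of_real t *s u"
      have ny: "norm ?y = t" using t u by (simp add: norm_vector_scale)
      then have "norm (U ?y) = t" using norm_U [of ?y] t by simp
      moreover have "norm (D ?y) = t * norm (D u)" using t by (simp add: D norm_vector_scale)
      moreover have "norm (U ?y - D ?y) \<le> e * t" using d(2) [of ?y] ny t by simp
      ultimately have "\<bar>t - t * norm (D u)\<bar> \<le> e * t"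
        using norm_triangle_ineq3 [of "U ?y" "D ?y"] by simp
      then have "t * \<bar>1 - norm (D u)\<bar> \<le> t * e"
        using t abs_mult [of t "1 - norm (D u)"] by (simp add: algebra_simps)
      then show ?thesis using t by simp
    qed
    then have "\<bar>1 - norm (D u)\<bar> \<le> 0" by (rule field_le_epsilon) auto
    then show ?thesis by simp
  qed
  have norm_D: "norm (D v) = norm v" for v
  proof -
    obtain u where "norm u = 1" "v = of_real (norm v) *s u" by (rule unit_vector_decomposition)
    then show ?thesis by (metis D(2) norm_D1 norm_vector_scale)
  qed
  have UD: "U v = D v" if v: "v \<in> unit_ball" for v
  proof -
    obtain u where u: "norm u = 1" "v = of_real (norm v) *s u" by (rule unit_vector_decomposition)
    let ?h = "\<lambda>\<zeta>. cdot (U (\<zeta> *s u)) (D u)"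
    have "(?h has_field_derivative cdot (D u) (D u)) (at 0)"
      by (rule analytic_slice) (use D in auto)
    then have dh: "(?h has_field_derivative 1) (at 0)"
      using norm_D u by (simp add: cdot_self)
    \<comment> \<open>The derivative of \<open>?h\<close> at 0 is 1, so equality holds in the
      Schwarz lemma and \<open>?h\<close> is linear; comparing derivatives then gives \<alpha> =
      1.\<close>
    have "\<exists>\<alpha>. (\<forall>\<zeta>. cmod \<zeta> < 1 \<longrightarrow> ?h \<zeta> = \<alpha> * \<zeta>) \<and> norm \<alpha> = 1"
    proof (rule Schwarz_Lemma(3) [where \<xi> = 0])
      show "?h holomorphic_on ball 0 1" using U u by (intro holomorphic_slice) auto
      show "cmod (?h \<zeta>) < 1" if "cmod \<zeta> < 1" for \<zeta>
        using norm_cdot_le [of "U (\<zeta> *s u)" "D u"] norm_U [of "\<zeta> *s u"] that u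
        by (simp add: norm_vector_scale norm_D)
      show "(\<exists>z. cmod z < 1 \<and> z \<noteq> 0 \<and> cmod (?h z) = cmod z) \<or> cmod (deriv ?h 0) = 1"
        using DERIV_imp_deriv [OF dh] by simp
    qed (use U0 in auto)
    then obtain \<alpha> where \<alpha>: "\<And>\<zeta>. cmod \<zeta> < 1 \<Longrightarrow> ?h \<zeta> = \<alpha> * \<zeta>" by blast
    have "((\<lambda>\<zeta>. \<alpha> * \<zeta>) has_field_derivative 1) (at 0)"
      by (rule has_field_derivative_transform_within [OF dh, of 1]) (auto simp: \<alpha>)
    moreover have "((\<lambda>\<zeta>. \<alpha> * \<zeta>) has_field_derivative \<alpha>) (at 0)"
      by (auto intro!: derivative_eq_intros)
    ultimately have "\<alpha> = 1" by (metis DERIV_unique)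
    then have "cdot (U v) (D u) = of_real (norm v)"
      using \<alpha> [of "of_real (norm v)"] u(2) v by simp
    moreover have "D v = of_real (norm v) *s D u" using u(2) D(2) by metis
    ultimately have UDv: "cdot (U v) (D v) = of_real ((norm v)\<^sup>2)"
      by (simp add: power2_eq_square)
    then have "cdot (D v) (U v) = of_real ((norm v)\<^sup>2)"
      by (metis cnj_cdot complex_cnj_complex_of_real)
    \<comment> \<open>Equality case of Cauchy-Schwarz: both vectors have norm \<open>norm v\<close>,
      and their product is its square.\<close>
    then have "cdot (U v - D v) (U v - D v) = 0"
      using UDv norm_U [OF v] norm_D by (simp only: cdot_linear) (simp add: cdot_self)
    then show ?thesis by (simp add: cdot_self del: cdot_linear)
  qed
  have "orthogonal_transformation D"
    using D.linear_axioms norm_D by (simp add: orthogonal_transformation)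
  then have Re_D: "Re (cdot (D x) (D y)) = Re (cdot x y)" for x y
    by (simp add: Re_cdot orthogonal_transformation_def)
  have "Im (cdot (D z) (D w)) = Im (cdot z w)"
    unfolding Im_cdot D(2) [symmetric] by (rule Re_D)
  then have "cdot (D z) (D w) = cdot z w" using Re_D by (intro complex_eqI)
  then show ?thesis by (simp only: UD assms)
qed

text \<open>The involution swaps \<open>0\<close> and \<open>a\<close>, so its composite with \<phi>
  and the inverse of that composite both fix 0. Schwarz in both directions makes the composite norm
  preserving, hence \<open>cdot\<close> preserving, and the identity is inherited from the
  involution.\<close>

lemma ball_automorphism_cdot:
  assumes \<phi>: "ball_automorphism \<phi>" and a: "a \<in> unit_ball" "\<phi> a = 0"
    and z: "z \<in> unit_ball" and w: "w \<in> unit_ball"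
  shows "(1 - cdot (\<phi> z) (\<phi> w)) * ((1 - cdot z a) * (1 - cdot a w)) = (1 - cdot a a) * (1 - cdot z w)"
proof -
  let ?\<sigma> = "ball_involution a" and ?\<phi>' = "inv_into unit_ball \<phi>"
  have bij: "bij_betw \<phi> unit_ball unit_ball" using \<phi> by (simp add: ball_automorphism_def)
  have in_ball: "\<phi> x \<in> unit_ball" "?\<phi>' x \<in> unit_ball" "?\<sigma> x \<in> unit_ball" if "x \<in> unit_ball" for x
    using bij_betwE [OF bij] bij_betwE [OF bij_betw_inv_into [OF bij]] that
      ball_involution_in_ball [OF a(1)] by blast+
  define U where "U x = \<phi> (?\<sigma> x)" for x
  define U' where "U' x = ?\<sigma> (?\<phi>' x)" for x
  have \<phi>_an: "analytic_map_on unit_ball \<phi>" "analytic_map_on unit_ball ?\<phi>'"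
    using \<phi> by (simp_all add: ball_automorphism_def)
  have "analytic_map_on unit_ball U"
    unfolding U_def
    by (rule analytic_map_on_compose [OF analytic_ball_involution [OF a(1)] \<phi>_an(1)])
       (use in_ball in blast)
  moreover have "analytic_map_on unit_ball U'"
    unfolding U'_def
    by (rule analytic_map_on_compose [OF \<phi>_an(2) analytic_ball_involution [OF a(1)]])
       (use in_ball in blast)
  ultimately have an: "analytic_self_map U" "analytic_self_map U'"
    unfolding analytic_self_map_def U_def U'_def image_subset_iff using in_ball by blast+
  have "?\<phi>' 0 = a" using bij a by (metis bij_betw_inv_into_left)
  then have 0: "U 0 = 0" "U' 0 = 0"
    using a by (simp_all add: U_def U'_def ball_involution_self)
  have norm_U: "norm (U x) = norm x" if "x \<in> unit_ball" for x
  proof (rule antisym)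
    show "norm (U x) \<le> norm x" using an 0 that by (intro Schwarz_ball)
    have "U x \<in> unit_ball" using in_ball that by (simp add: U_def)
    then have "norm (U' (U x)) \<le> norm (U x)" using an 0 by (intro Schwarz_ball)
    moreover have "U' (U x) = x"
      unfolding U_def U'_def using that in_ball bij
      by (simp add: bij_betw_inv_into_left [OF bij] ball_involution_involutive [OF a(1)]
          del: mem_ball mem_ball_0)
    ultimately show "norm x \<le> norm (U x)" by simp
  qed
  have "cdot (U (?\<sigma> z)) (U (?\<sigma> w)) = cdot (?\<sigma> z) (?\<sigma> w)"
    using an norm_U in_ball z w
    by (intro norm_preserving_imp_cdot_preserving) (auto simp: analytic_self_map_def)
  then have "cdot (\<phi> z) (\<phi> w) = cdot (?\<sigma> z) (?\<sigma> w)"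
    using z w by (simp add: U_def ball_involution_involutive [OF a(1)])
  then show ?thesis using ball_involution_cdot [OF a(1) z w] by simp
qed

section \<open>Adjoints on a Hilbert space of functions\<close>

context function_hilbert_space
begin

lemma ip_add_right:
  assumes "h \<in> H" "k \<in> H" "l \<in> H"
  shows "ip l (\<lambda>z. h z + k z) = ip l h + ip l k"
  using ip_cnj [OF add_mem [OF assms(1,2)] assms(3)] ip_cnj [OF assms(1,3)] ip_cnj [OF assms(2,3)]
  by (simp add: ip_add assms)

lemma ip_scale_right:
  assumes "h \<in> H" "l \<in> H"
  shows "ip l (\<lambda>z. c * h z) = cnj c * ip l h"
  using ip_cnj [OF scale_mem [OF assms(1)] assms(2), of c] ip_cnj [OF assms]
  by (simp add: ip_scale assms)

lemma diff_mem: "(\<lambda>z. h z - k z) \<in> H" if "h \<in> H" "k \<in> H"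
  using add_mem [OF that(1) scale_mem [OF that(2), of "-1"]] by simp

lemma ip_diff_left:
  assumes "h \<in> H" "k \<in> H" "l \<in> H"
  shows "ip (\<lambda>z. h z - k z) l = ip h l - ip k l"
  using ip_add [OF assms(1) scale_mem [OF assms(2), of "-1"] assms(3)]
    ip_scale [OF assms(2,3), of "-1"] by simp

lemma ip_diff_right:
  assumes "h \<in> H" "k \<in> H" "l \<in> H"
  shows "ip l (\<lambda>z. h z - k z) = ip l h - ip l k"
  using ip_cnj [OF diff_mem [OF assms(1,2)] assms(3)] ip_cnj [OF assms(1,3)] ip_cnj [OF assms(2,3)]
  by (simp add: ip_diff_left assms)

lemmas ip_simps = add_mem scale_mem diff_mem ip_add ip_scale ip_add_right ip_scale_right
  ip_diff_left ip_diff_right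

lemma ip_self: "h \<in> H \<Longrightarrow> ip h h = of_real (Re (ip h h))"
  using ip_cnj [of h h] by (simp add: complex_eq_iff)

lemma ip_norm_nonneg: "h \<in> H \<Longrightarrow> 0 \<le> ip_norm ip h"
  by (simp add: ip_norm_def ip_nonneg)

lemma ip_norm_power2: "h \<in> H \<Longrightarrow> (ip_norm ip h)\<^sup>2 = Re (ip h h)"
  by (simp add: ip_norm_def ip_nonneg)

lemma ip_right_cancel:
  assumes "u \<in> H" "v \<in> H" "\<And>h. h \<in> H \<Longrightarrow> ip h u = ip h v"
  shows "u = v"
proof -
  have "ip (\<lambda>z. u z - v z) (\<lambda>z. u z - v z) = 0"
    using assms by (simp add: ip_diff_right diff_mem)
  from ip_definite [OF diff_mem [OF assms(1,2)] this] show ?thesis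
    by (simp add: fun_eq_iff)
qed

section \<open>Cauchy-Schwarz inequality and Riesz representation\<close>

lemma ip_Cauchy_Schwarz:
  assumes h: "h \<in> H" and k: "k \<in> H"
  shows "cmod (ip h k) \<le> ip_norm ip h * ip_norm ip k"
proof (cases "ip k k = 0")
  case True
  then have "k = (\<lambda>z. 0)" using ip_definite k by blast
  then have "ip h k = 0" using ip_scale_right [OF zero_mem h, of 0] by simp
  then show ?thesis using ip_norm_nonneg h k by simp
next
  case False
  define A where "A = Re (ip h h)"
  define B where "B = Re (ip k k)"
  have kk: "ip k k = of_real B" and hh: "ip h h = of_real A"
    using ip_self h k by (simp_all add: A_def B_def)
  then have B: "B > 0" using False ip_nonneg [OF k] by (metis B_def less_eq_real_def of_real_0)
  \<comment> \<open>\<open>c\<close> is the coefficient of the orthogonal projection of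
    \<open>h\<close> onto the line of \<open>k\<close>; the inequality is nonnegativity of the
    squared distance.\<close>
  define c where "c = ip h k / of_real B"
  have kh: "ip k h = cnj (ip h k)" using ip_cnj h k by blast
  have q: "cnj (ip h k) * ip h k = of_real ((cmod (ip h k))\<^sup>2)"
    by (metis complex_norm_square mult.commute)
  have c1: "cnj c * of_real B = cnj (ip h k)" and c2: "cnj c * ip h k = of_real ((cmod (ip h k))\<^sup>2 / B)"
    using B by (simp_all add: c_def q of_real_divide del: of_real_power)
  have "ip (\<lambda>z. h z - c * k z) (\<lambda>z. h z - c * k z) =
      ip h h - cnj c * ip h k - c * (ip k h - cnj c * ip k k)"
    using h k by (simp add: ip_simps algebra_simps)
  also have "\<dots> = of_real (A - (cmod (ip h k))\<^sup>2 / B)"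
    unfolding hh kk kh c1 c2 by simp
  finally have "0 \<le> A - (cmod (ip h k))\<^sup>2 / B"
    using ip_nonneg [OF diff_mem [OF h scale_mem [OF k, of c]]] by (simp only: Re_complex_of_real)
  then have "(cmod (ip h k))\<^sup>2 \<le> (ip_norm ip h * ip_norm ip k)\<^sup>2"
    using B h k by (simp add: field_simps power_mult_distrib ip_norm_power2 flip: A_def B_def)
  then show ?thesis using ip_norm_nonneg h k by (meson mult_nonneg_nonneg power2_le_imp_le)
qed

text \<open>The representing element minimises \<open>J v = \<parallel>v\<parallel>\<^sup>2 - 2 Re (L v)\<close>; by the parallelogram law every
  minimising sequence is a Cauchy sequence.\<close>

theorem Riesz_representation:
  assumes L_add: "\<And>h k. h \<in> H \<Longrightarrow> k \<in> H \<Longrightarrow> L (\<lambda>z. h z + k z) = L h + L k"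
    and L_scale: "\<And>c h. h \<in> H \<Longrightarrow> L (\<lambda>z. c * h z) = c * L h"
    and L_bounded: "\<And>h. h \<in> H \<Longrightarrow> cmod (L h) \<le> C * ip_norm ip h"
  obtains u where "u \<in> H" "\<And>v. v \<in> H \<Longrightarrow> L v = ip v u"
proof -
  define N where "N v = Re (ip v v)" for v
  define J where "J v = N v - 2 * Re (L v)" for v
  have Re_sym: "Re (ip k h) = Re (ip h k)" if "h \<in> H" "k \<in> H" for h k
    using ip_cnj [OF that] by simp
  \<comment> \<open>Completing the square: \<open>J v\<close> is at least
    \<open>(ip_norm ip v - C)\<^sup>2 - C\<^sup>2\<close>.\<close>
  have lower: "- (C\<^sup>2) \<le> J v" if v: "v \<in> H" for v
  proof -
    have "Re (L v) \<le> C * ip_norm ip v"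
      using complex_Re_le_cmod [of "L v"] L_bounded [OF v] by linarith
    moreover have "N v = (ip_norm ip v)\<^sup>2" using v by (simp add: N_def ip_norm_power2)
    moreover have "0 \<le> (ip_norm ip v - C)\<^sup>2" by simp
    ultimately show ?thesis by (simp add: J_def power2_eq_square algebra_simps)
  qed
  define m where "m = Inf (J ` H)"
  have m: "m \<le> J v" if "v \<in> H" for v
    unfolding m_def using that lower by (intro cInf_lower bdd_belowI2) auto
  have "\<exists>v\<in>H. J v < m + 1 / Suc i" for i
  proof -
    have "Inf (J ` H) < m + 1 / Suc i" by (simp add: m_def)
    then show ?thesis using cInf_lessD [of "J ` H"] zero_mem by blast
  qed
  then obtain s where s: "\<And>i. s i \<in> H" "\<And>i. J (s i) < m + 1 / Suc i" by metis
  \<comment> \<open>With \<open>p\<close> the midpoint, the left side equals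
    \<open>2 * J v + 2 * J w - 4 * J p\<close>, since the linear terms cancel; and
    \<open>m \<le> J p\<close>.\<close>
  have close: "N (\<lambda>z. v z - w z) \<le> 2 * J v + 2 * J w - 4 * m" if "v \<in> H" "w \<in> H" for v w
  proof -
    define p where "p = (\<lambda>z. (1/2) * (v z + w z))"
    have "m \<le> J p" unfolding p_def using that by (intro m scale_mem add_mem)
    moreover have "Re (L p) = (Re (L v) + Re (L w)) / 2"
      unfolding p_def L_scale [OF add_mem [OF that]] L_add [OF that] by simp
    moreover have "N p = (N v + Re (ip v w) + Re (ip w v) + N w) / 4"
    proof -
      have "ip (\<lambda>z. c * (v z + w z)) (\<lambda>z. c * (v z + w z)) =
          c * cnj c * (ip v v + ip v w + ip w v + ip w w)" for c
        using that ip_scale [OF add_mem [OF that] scale_mem [OF add_mem [OF that]], of c c]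
          ip_scale_right [OF add_mem [OF that] add_mem [OF that], of c]
        by (simp add: ip_simps algebra_simps)
      from this [of "1/2"] have "ip p p = 1/2 * cnj (1/2) * (ip v v + ip v w + ip w v + ip w w)"
        unfolding p_def .
      then show ?thesis unfolding N_def by (simp only:) simp
    qed
    moreover have "N (\<lambda>z. v z - w z) = N v - Re (ip v w) - Re (ip w v) + N w"
      using that by (simp add: N_def ip_simps)
    ultimately show ?thesis by (simp add: J_def field_simps)
  qed
  have "\<exists>u\<in>H. (\<lambda>i. ip_norm ip (\<lambda>z. s i z - u z)) \<longlonglongrightarrow> 0"
  proof (rule complete)
    fix e :: real assume "e > 0"
    then obtain M where M: "inverse (real (Suc M)) < e\<^sup>2 / 4"
      using reals_Archimedean [of "e\<^sup>2 / 4"] by auto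
    have "ip_norm ip (\<lambda>z. s i z - s j z) < e" if "i \<ge> M" "j \<ge> M" for i j
    proof -
      have "1 / real (Suc i) \<le> inverse (real (Suc M))" "1 / real (Suc j) \<le> inverse (real (Suc M))"
        using that by (simp_all add: field_simps)
      with M s(2) [of i] s(2) [of j] close [OF s(1) s(1), of i j]
      have "N (\<lambda>z. s i z - s j z) < e\<^sup>2" by linarith
      then show ?thesis using \<open>e > 0\<close> unfolding ip_norm_def N_def by (intro real_less_lsqrt) auto
    qed
    then show "\<exists>M. \<forall>i\<ge>M. \<forall>j\<ge>M. ip_norm ip (\<lambda>z. s i z - s j z) < e" by blast
  qed (rule s)
  then obtain u where u: "u \<in> H" and lim: "(\<lambda>i. ip_norm ip (\<lambda>z. s i z - u z)) \<longlonglongrightarrow> 0" by blast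
  \<comment> \<open>Expanding \<open>J\<close> around \<open>u\<close> bounds its change by a
    multiple of the distance to \<open>s i\<close>, so the limit \<open>u\<close> attains the
    infimum.\<close>
  have "J u \<le> m + 1 / Suc i + 2 * (ip_norm ip u + C) * ip_norm ip (\<lambda>z. s i z - u z)" for i
  proof -
    define d where "d = (\<lambda>z. s i z - u z)"
    have d: "d \<in> H" unfolding d_def using s u by (intro diff_mem)
    have si: "s i = (\<lambda>z. u z + d z)" by (simp add: d_def)
    have "J (s i) = J u + N d + 2 * Re (ip u d) - 2 * Re (L d)"
      using u d Re_sym [OF u d] by (simp add: si J_def N_def L_add ip_simps)
    moreover have "N d \<ge> 0" using d by (simp add: N_def ip_nonneg)
    moreover have "- Re (ip u d) \<le> ip_norm ip u * ip_norm ip d"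
      using ip_Cauchy_Schwarz [OF u d] abs_Re_le_cmod [of "ip u d"] by linarith
    moreover have "Re (L d) \<le> C * ip_norm ip d"
      using L_bounded [OF d] abs_Re_le_cmod [of "L d"] by linarith
    ultimately have "J u \<le> J (s i) + 2 * (ip_norm ip u + C) * ip_norm ip d"
      by (simp add: algebra_simps)
    then show ?thesis using s(2) [of i] by (simp flip: d_def)
  qed
  moreover have lim': "(\<lambda>i. m + 1 / Suc i + 2 * (ip_norm ip u + C) * ip_norm ip (\<lambda>z. s i z - u z))
      \<longlonglongrightarrow> m + 0 + 2 * (ip_norm ip u + C) * 0"
    using lim LIMSEQ_inverse_real_of_nat by (intro tendsto_intros) (simp add: inverse_eq_divide)
  ultimately have Ju: "J u \<le> m"
    using LIMSEQ_le_const [OF lim', of "J u"] by simp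
  \<comment> \<open>First variation: the quadratic polynomial \<open>J (u + t v) - J u\<close> in
    the real variable \<open>t\<close> is nonnegative, which forces its linear coefficient to
    vanish.\<close>
  have Re_eq: "Re (L v) = Re (ip v u)" if v: "v \<in> H" for v
  proof -
    define q where "q = Re (ip v u) - Re (L v)"
    have pos: "0 \<le> t\<^sup>2 * N v + 2 * t * q" for t
    proof -
      have tv: "(\<lambda>z. of_real t * v z) \<in> H" using v by (rule scale_mem)
      have "J (\<lambda>z. u z + of_real t * v z) = J u + t\<^sup>2 * N v + 2 * t * q"
      proof -
        have "ip (\<lambda>z. u z + of_real t * v z) (\<lambda>z. u z + of_real t * v z) =
            ip u u + of_real t * (ip u v + ip v u) + of_real (t * t) * ip v v"
          using u v tv by (simp add: ip_simps algebra_simps)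
        moreover have "L (\<lambda>z. u z + of_real t * v z) = L u + of_real t * L v"
          using u v tv by (simp add: L_add L_scale)
        ultimately show ?thesis
          using Re_sym [OF u v] by (simp add: J_def N_def q_def power2_eq_square algebra_simps)
      qed
      then show ?thesis using m [OF add_mem [OF u tv]] Ju by simp
    qed
    have "N v \<ge> 0" using v by (simp add: N_def ip_nonneg)
    have "q = 0"
    proof (rule ccontr)
      assume "q \<noteq> 0"
      \<comment> \<open>Nearly the minimiser \<open>- q / N v\<close> of the quadratic; the added 1
        keeps the denominator positive when \<open>N v = 0\<close>.\<close>
      define t where "t = - q / (N v + 1)"
      have "t * (N v + 1) = - q" using \<open>N v \<ge> 0\<close> by (simp add: t_def)
      then have "t\<^sup>2 * N v + 2 * t * q = t * q - t\<^sup>2"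
        by algebra
      also have "t * q = - (q\<^sup>2) / (N v + 1)" by (simp add: t_def power2_eq_square)
      also have "\<dots> < 0" using \<open>q \<noteq> 0\<close> \<open>N v \<ge> 0\<close> by (simp add: divide_neg_pos)
      finally show False using pos [of t] zero_le_power2 [of t] by linarith
    qed
    then show ?thesis by (simp add: q_def)
  qed
  show thesis
  proof
    \<comment> \<open>The equality of real parts, applied to \<i> times \<open>v\<close>, supplies
      the imaginary parts.\<close>
    show "L v = ip v u" if v: "v \<in> H" for v
      using Re_eq [OF v] Re_eq [OF scale_mem [OF v, of \<i>]] u v
      by (simp add: complex_eq_iff L_scale ip_scale)
  qed (rule u)
qed

section \<open>Existence of adjoints and a criterion for unitarity\<close>

lemma adjoint_on_eqI:
  assumes "u \<in> H" "\<And>v. v \<in> H \<Longrightarrow> ip (T v) h = ip v u"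
  shows "adjoint_on H ip T h = u"
  unfolding adjoint_on_def
  by (rule the_equality) (use assms in \<open>auto intro!: ip_right_cancel\<close>)

lemma adjoint_on_properties:
  assumes T: "bounded_operator_on H ip T" and h: "h \<in> H"
  shows "adjoint_on H ip T h \<in> H" "\<And>v. v \<in> H \<Longrightarrow> ip (T v) h = ip v (adjoint_on H ip T h)"
proof -
  obtain C where C: "\<And>v. v \<in> H \<Longrightarrow> ip_norm ip (T v) \<le> C * ip_norm ip v"
    using T unfolding bounded_operator_on_def by blast
  have T_mem: "T v \<in> H" if "v \<in> H" for v
    using T that unfolding bounded_operator_on_def by blast
  obtain u where u: "u \<in> H" "\<And>v. v \<in> H \<Longrightarrow> ip (T v) h = ip v u"
  proof (rule Riesz_representation [where L = "\<lambda>v. ip (T v) h" and C = "C * ip_norm ip h"])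
    show "ip (T (\<lambda>z. v z + w z)) h = ip (T v) h + ip (T w) h" if "v \<in> H" "w \<in> H" for v w
      using T that h T_mem by (simp add: bounded_operator_on_def ip_add)
    show "ip (T (\<lambda>z. c * v z)) h = c * ip (T v) h" if "v \<in> H" for c v
      using T that h T_mem by (simp add: bounded_operator_on_def ip_scale)
    show "cmod (ip (T v) h) \<le> C * ip_norm ip h * ip_norm ip v" if "v \<in> H" for v
    proof -
      have "cmod (ip (T v) h) \<le> ip_norm ip (T v) * ip_norm ip h"
        using T_mem that h by (intro ip_Cauchy_Schwarz)
      also have "\<dots> \<le> (C * ip_norm ip v) * ip_norm ip h"
        using C that h by (intro mult_right_mono ip_norm_nonneg)
      finally show ?thesis by (simp add: mult_ac)
    qed
  qed blast
  then show "adjoint_on H ip T h \<in> H" "\<And>v. v \<in> H \<Longrightarrow> ip (T v) h = ip v (adjoint_on H ip T h)"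
    using adjoint_on_eqI [of u T h] by simp_all
qed

lemma bounded_operator_on_scale:
  assumes T: "bounded_operator_on H ip T" and S: "\<And>h. h \<in> H \<Longrightarrow> S h = (\<lambda>z. c * T h z)"
  shows "bounded_operator_on H ip S"
proof -
  obtain C where C: "\<And>v. v \<in> H \<Longrightarrow> ip_norm ip (T v) \<le> C * ip_norm ip v"
    and T_mem: "\<And>v. v \<in> H \<Longrightarrow> T v \<in> H"
    using T unfolding bounded_operator_on_def by blast
  have "ip_norm ip (S v) \<le> (cmod c * C) * ip_norm ip v" if v: "v \<in> H" for v
  proof -
    have "ip (S v) (S v) = of_real ((cmod c)\<^sup>2) * ip (T v) (T v)"
      unfolding complex_norm_square using S T_mem v by (simp add: ip_simps)
    then have "ip_norm ip (S v) = cmod c * ip_norm ip (T v)"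
      by (simp add: ip_norm_def real_sqrt_mult flip: of_real_power)
    then show ?thesis using mult_left_mono [OF C [OF v], of "cmod c"] by (simp add: mult_ac)
  qed
  moreover have "S (\<lambda>z. v z + w z) = (\<lambda>z. S v z + S w z)" if "v \<in> H" "w \<in> H" for v w
    using T that by (simp add: bounded_operator_on_def S add_mem algebra_simps)
  moreover have "S (\<lambda>z. d * v z) = (\<lambda>z. d * S v z)" if "v \<in> H" for d v
    using T that by (simp add: bounded_operator_on_def S scale_mem mult_ac)
  moreover have "S v \<in> H" if "v \<in> H" for v
    using S T_mem that by (simp add: scale_mem)
  ultimately show ?thesis unfolding bounded_operator_on_def by blast
qed

text \<open>The right-inverse property at \<open>T h\<close> says that \<open>T\<close> maps both
  \<open>h\<close> and the adjoint's value at \<open>T h\<close> to \<open>T h\<close>; injectivity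
  identifies the two.\<close>

lemma unitary_on_if_coisometry:
  assumes T: "bounded_operator_on H ip T"
    and inj: "\<And>h k. h \<in> H \<Longrightarrow> k \<in> H \<Longrightarrow> T h = T k \<Longrightarrow> h = k"
    and co: "\<And>h. h \<in> H \<Longrightarrow> T (adjoint_on H ip T h) = h"
  shows "unitary_on H ip T"
proof -
  have "adjoint_on H ip T (T h) = h" if "h \<in> H" for h
  proof (rule inj)
    have "T h \<in> H" using T that by (simp add: bounded_operator_on_def)
    then show "T (adjoint_on H ip T (T h)) = T h" "adjoint_on H ip T (T h) \<in> H"
      using co adjoint_on_properties [OF T] by blast+
  qed (rule that)
  with T co show ?thesis by (simp add: unitary_on_def)
qed

end

section \<open>The kernel identity\<close>

lemma ball_kernel_nz: "ball_kernel \<gamma> z w \<noteq> 0" if "z \<in> unit_ball" "w \<in> unit_ball"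
  using one_minus_cdot_nz [OF that(2,1)] by (simp add: ball_kernel_def powr_def)

lemma ball_kernel_exp:
  assumes "z \<in> unit_ball" "w \<in> unit_ball"
  shows "ball_kernel \<gamma> z w = exp (- (of_real \<gamma> * Ln (1 - cdot w z)))"
  using one_minus_cdot_nz [OF assms(2,1)] by (simp add: ball_kernel_def powr_def)

lemma cnj_ball_kernel:
  assumes "z \<in> unit_ball" "w \<in> unit_ball"
  shows "cnj (ball_kernel \<gamma> z w) = ball_kernel \<gamma> w z"
proof -
  have "Ln (cnj (1 - cdot w z)) = cnj (Ln (1 - cdot w z))"
    using Re_one_minus_cdot [OF assms(2,1)]
    by (intro cnj_Ln [symmetric]) (auto simp: complex_nonpos_Reals_iff)
  then show ?thesis using assms by (simp add: ball_kernel_exp exp_cnj)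
qed

lemma ball_kernel_0 [simp]: "ball_kernel \<gamma> 0 z = 1" "ball_kernel \<gamma> z 0 = 1"
  by (simp_all add: ball_kernel_def)

text \<open>Four arguments below \<pi>/2 in modulus leave the imaginary parts of the two sides less
  than 2\<pi> apart, so equal exponentials give equal logarithms.\<close>

lemma Ln_right_half_plane_prod:
  assumes "0 < Re p" "0 < Re q" "0 < Re r" "0 < Re s" "t > 0"
    and "p * (q * r) = of_real t * s"
  shows "Ln p + Ln q + Ln r = of_real (ln t) + Ln s"
proof (rule exp_complex_eqI)
  have "\<bar>Im (Ln x)\<bar> < pi / 2" if "0 < Re x" for x
    using that Re_Ln_pos_lt by (metis zero_complex.simps(1) less_irrefl)
  from this [of p] this [of q] this [of r] this [of s]
  show "\<bar>Im (Ln p + Ln q + Ln r) - Im (of_real (ln t) + Ln s)\<bar> < 2 * pi"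
    using assms by simp
  show "exp (Ln p + Ln q + Ln r) = exp (of_real (ln t) + Ln s)"
  proof -
    have "p \<noteq> 0" "q \<noteq> 0" "r \<noteq> 0" "s \<noteq> 0" using assms by auto
    then show ?thesis using assms by (simp add: exp_add mult.assoc exp_of_real)
  qed
qed

text \<open>Principal powers are not multiplicative in general, so the assumed product is first
  turned into a sum of logarithms and only then multiplied by \<gamma>.\<close>

lemma normalized_kernel_identity:
  assumes a: "a \<in> unit_ball" and z: "z \<in> unit_ball" and w: "w \<in> unit_ball"
    and z': "z' \<in> unit_ball" and w': "w' \<in> unit_ball"
    and eq: "(1 - cdot z' w') * ((1 - cdot z a) * (1 - cdot a w)) = (1 - cdot a a) * (1 - cdot z w)"
  shows "normalized_kernel \<gamma> a z * cnj (normalized_kernel \<gamma> a w) * ball_kernel \<gamma> w' z' =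
    ball_kernel \<gamma> w z"
proof -
  define t where "t = 1 - (norm a)\<^sup>2"
  have t: "t > 0" using a by (simp add: t_def abs_square_less_1)
  have "Ln (1 - cdot z' w') + Ln (1 - cdot z a) + Ln (1 - cdot a w) = of_real (ln t) + Ln (1 - cdot z w)"
    using eq t by (intro Ln_right_half_plane_prod Re_one_minus_cdot assms)
      (simp_all add: t_def cdot_self)
  then have Ln_eq: "of_real (ln t) - Ln (1 - cdot z a) - Ln (1 - cdot a w) - Ln (1 - cdot z' w') =
      - Ln (1 - cdot z w)"
    by (simp add: algebra_simps)
  have "complex_of_real (t powr (\<gamma> / 2)) * of_real (t powr (\<gamma> / 2)) = exp (of_real \<gamma> * of_real (ln t))"
    using t by (simp add: powr_def flip: of_real_mult exp_of_real exp_add)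
  then have "normalized_kernel \<gamma> a z * cnj (normalized_kernel \<gamma> a w) * ball_kernel \<gamma> w' z' =
     exp (of_real \<gamma> * of_real (ln t)) * ball_kernel \<gamma> a z * ball_kernel \<gamma> w a * ball_kernel \<gamma> w' z'"
    by (simp add: normalized_kernel_def cnj_ball_kernel [OF a w] mult_ac flip: t_def)
  also have "\<dots> = exp (of_real \<gamma> *
      (of_real (ln t) - Ln (1 - cdot z a) - Ln (1 - cdot a w) - Ln (1 - cdot z' w')))"
    using assms by (simp add: ball_kernel_exp algebra_simps flip: exp_add)
  also have "\<dots> = ball_kernel \<gamma> w z"
    unfolding Ln_eq using z w by (simp add: ball_kernel_exp)
  finally show ?thesis .
qed

text \<open>A continuous logarithm of the constant \<open>1\<close> on a segment is constant, since \<open>exp\<close> is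
  injective on strips of height below \<open>2\<pi>\<close>.\<close>

lemma continuous_log_of_one:
  fixes c :: "real \<Rightarrow> complex"
  assumes "continuous_on {0..1} c" "\<And>t. t \<in> {0..1} \<Longrightarrow> exp (c t) = 1" "c 0 = 0"
  shows "c 1 = 0"
proof -
  have "c constant_on {0..1}"
  proof (rule continuous_discrete_range_constant)
    fix x :: real assume x: "x \<in> {0..1}"
    have "2 * pi \<le> cmod (c y - c x)" if "y \<in> {0..1}" "c y \<noteq> c x" for y
      using exp_complex_eqI [of "c y" "c x"] assms(2) [OF x] assms(2) [OF that(1)] that(2)
        abs_Im_le_cmod [of "c y - c x"] by fastforce
    then show "\<exists>e>0. \<forall>y. y \<in> {0..1} \<and> c y \<noteq> c x \<longrightarrow> e \<le> cmod (c y - c x)"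
      by (intro exI [of _ "2 * pi"]) auto
  qed (use assms in auto)
  then obtain k where "\<And>t. t \<in> {0..1} \<Longrightarrow> c t = k" by (auto simp: constant_on_def)
  from this [of 0] this [of 1] assms(3) show ?thesis by simp
qed

text \<open>In \<open>f z * cnj (g w)\<close> the variables are separated, so the cross ratio of its
  values at \<open>(z, w)\<close>, \<open>(0, 0)\<close>, \<open>(z, 0)\<close> and
  \<open>(0, w)\<close> is 1. This eliminates the weights; following the logarithm along the
  segments from 0 to \<open>z\<close> and \<open>w\<close> then eliminates \<gamma>.\<close>

lemma kernel_identity_without_exponent:
  fixes \<phi> \<psi> :: "complex ^ 'n \<Rightarrow> complex ^ 'n"
  assumes \<phi>: "analytic_self_map \<phi>" and \<psi>: "analytic_self_map \<psi>" and "\<gamma> > 0"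
    and id: "\<And>z w. z \<in> unit_ball \<Longrightarrow> w \<in> unit_ball \<Longrightarrow>
      f z * cnj (g w) * ball_kernel \<gamma> (\<psi> w) (\<phi> z) = ball_kernel \<gamma> w z"
    and z: "z \<in> unit_ball" and w: "w \<in> unit_ball"
  shows "(1 - cdot (\<phi> z) (\<psi> w)) * (1 - cdot (\<phi> 0) (\<psi> 0)) =
    (1 - cdot z w) * ((1 - cdot (\<phi> z) (\<psi> 0)) * (1 - cdot (\<phi> 0) (\<psi> w)))"
proof -
  have ball: "\<phi> x \<in> unit_ball" "\<psi> x \<in> unit_ball" if "x \<in> unit_ball" for x
    using \<phi> \<psi> that unfolding analytic_self_map_def by blast+
  have t_ball: "t *\<^sub>R x \<in> unit_ball" if "t \<in> {0..1}" "x \<in> unit_ball" for t and x :: "complex ^ 'n"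
  proof -
    have "\<bar>t\<bar> * norm x \<le> 1 * norm x" using that by (intro mult_right_mono) auto
    then show ?thesis using that by simp
  qed
  define L where "L x y = Ln (1 - cdot (\<phi> x) (\<psi> y))" for x y
  \<comment> \<open>\<open>exp (c t)\<close> is the cross ratio at the scaled points, expressed
    through principal logarithms, which are continuous here.\<close>
  define c where "c t = of_real \<gamma> * (L (t *\<^sub>R z) (t *\<^sub>R w) - Ln (1 - cdot (t *\<^sub>R z) (t *\<^sub>R w)) + L 0 0
      - L (t *\<^sub>R z) 0 - L 0 (t *\<^sub>R w))" for t
  have F: "f x * cnj (g y) = exp (of_real \<gamma> * (L x y - Ln (1 - cdot x y)))"
    if "x \<in> unit_ball" "y \<in> unit_ball" for x y
  proof -
    have "f x * cnj (g y) * exp (- (of_real \<gamma> * L x y)) = exp (- (of_real \<gamma> * Ln (1 - cdot x y)))"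
      using id [OF that] that ball by (simp add: ball_kernel_exp L_def)
    then have "f x * cnj (g y) = exp (of_real \<gamma> * L x y) * exp (- (of_real \<gamma> * Ln (1 - cdot x y)))"
      by (simp add: exp_minus field_simps)
    then show ?thesis by (simp add: algebra_simps flip: exp_add)
  qed
  have exp_c: "exp (c t) = 1" if t: "t \<in> {0..1}" for t
  proof -
    let ?x = "t *\<^sub>R z" and ?y = "t *\<^sub>R w"
    have b: "?x \<in> unit_ball" "?y \<in> unit_ball" "(0 :: complex ^ 'n) \<in> unit_ball"
      using t_ball t z w by auto
    have "(f ?x * cnj (g ?y)) * (f 0 * cnj (g 0)) = (f ?x * cnj (g 0)) * (f 0 * cnj (g ?y))"
      by simp
    then have "exp (of_real \<gamma> * (L ?x ?y - Ln (1 - cdot ?x ?y))) * exp (of_real \<gamma> * L 0 0) =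
        exp (of_real \<gamma> * L ?x 0) * exp (of_real \<gamma> * L 0 ?y)"
      unfolding F [OF b(1,2)] F [OF b(3,3)] F [OF b(1,3)] F [OF b(3,2)] by simp
    moreover have "exp (c t) = exp (of_real \<gamma> * (L ?x ?y - Ln (1 - cdot ?x ?y))) * exp (of_real \<gamma> * L 0 0) /
        (exp (of_real \<gamma> * L ?x 0) * exp (of_real \<gamma> * L 0 ?y))"
      unfolding exp_add [symmetric] exp_diff [symmetric] by (simp add: c_def algebra_simps)
    ultimately show ?thesis by simp
  qed
  have cont_path: "continuous_on {0..1} (\<lambda>t. t *\<^sub>R x)" for x :: "complex ^ 'n"
    by (intro continuous_intros)
  have cont: "continuous_on {0..1} (\<lambda>t. \<phi> (t *\<^sub>R z))" "continuous_on {0..1} (\<lambda>t. \<psi> (t *\<^sub>R w))"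
    using \<phi> \<psi> t_ball z w unfolding analytic_self_map_def
    by (auto intro!: continuous_on_compose2 [OF analytic_map_on_continuous cont_path])
  have cont_cdot: "continuous_on {0..1} (\<lambda>t. cdot (p t) (q t))"
    if "continuous_on {0..1} p" "continuous_on {0..1} q" for p q :: "real \<Rightarrow> complex ^ 'n"
    unfolding cdot_def using that by (intro continuous_intros)
  have cont_Ln: "continuous_on {0..1} (\<lambda>t. Ln (1 - cdot (p t) (q t)))"
    if "continuous_on {0..1} p" "continuous_on {0..1} q"
      "\<And>t. t \<in> {0..1} \<Longrightarrow> p t \<in> unit_ball" "\<And>t. t \<in> {0..1} \<Longrightarrow> q t \<in> unit_ball"
    for p q :: "real \<Rightarrow> complex ^ 'n"
  proof (rule continuous_on_Ln')
    show "continuous_on {0..1} (\<lambda>t. 1 - cdot (p t) (q t))"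
      using cont_cdot that by (intro continuous_intros)
    show "1 - cdot (p t) (q t) \<notin> \<real>\<^sub>\<le>\<^sub>0" if "t \<in> {0..1}" for t
      using Re_one_minus_cdot \<open>\<And>t. t \<in> {0..1} \<Longrightarrow> p t \<in> unit_ball\<close>
        \<open>\<And>t. t \<in> {0..1} \<Longrightarrow> q t \<in> unit_ball\<close> that
      by (fastforce simp: complex_nonpos_Reals_iff simp del: mem_ball mem_ball_0)
  qed
  have "continuous_on {0..1} c"
    unfolding c_def L_def
    by (intro continuous_intros cont_Ln cont cont_path ball t_ball z w) auto
  moreover have "c 0 = 0" by (simp add: c_def)
  ultimately have "c 1 = 0" using exp_c continuous_log_of_one [of c] by blast
  then have "L z w - Ln (1 - cdot z w) + L 0 0 - L z 0 - L 0 w = 0"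
    using \<open>\<gamma> > 0\<close> by (simp add: c_def)
  then have "L z w + L 0 0 = Ln (1 - cdot z w) + (L z 0 + L 0 w)"
    by (simp add: algebra_simps)
  then have "exp (L z w) * exp (L 0 0) = exp (Ln (1 - cdot z w)) * (exp (L z 0) * exp (L 0 w))"
    by (simp only: exp_add [symmetric])
  then show ?thesis
    unfolding L_def using z w by (simp add: exp_Ln one_minus_cdot_nz ball del: mem_ball mem_ball_0 right_minus_eq)
qed

section \<open>Equality of the two symbols and their automorphy\<close>

text \<open>The maximum principle on the disc of radius \<open>r\<close> carries the bound from the
  circle to the fixed point \<zeta>, and this bound tends to 0 as \<open>r\<close> tends to
  1.\<close>

lemma holomorphic_vanishing_at_circle:
  assumes h: "h holomorphic_on ball 0 1"
    and bound: "\<And>\<zeta>. cmod \<zeta> < 1 \<Longrightarrow> (cmod (h \<zeta>))\<^sup>2 \<le> C * (1 - (cmod \<zeta>)\<^sup>2)"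
    and \<zeta>: "cmod \<zeta> < 1"
  shows "h \<zeta> = 0"
proof -
  have "(cmod (h \<zeta>))\<^sup>2 \<le> C * (1 - r\<^sup>2)" if r: "cmod \<zeta> < r" "r < 1" for r
  proof -
    have "r > 0" using r norm_ge_zero [of \<zeta>] by linarith
    have "cmod (h \<zeta>) \<le> sqrt (C * (1 - r\<^sup>2))"
    proof (rule maximum_modulus_frontier [where S = "cball 0 r" and f = h])
      have sub: "cball 0 r \<subseteq> ball (0 :: complex) 1" using r by auto
      show "h holomorphic_on interior (cball 0 r)"
        using h sub interior_subset by (meson holomorphic_on_subset order_trans)
      show "continuous_on (closure (cball 0 r)) h"
        using holomorphic_on_imp_continuous_on [OF h] sub by (simp add: continuous_on_subset)
      show "cmod (h x) \<le> sqrt (C * (1 - r\<^sup>2))" if "x \<in> frontier (cball 0 r)" for x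
        using that bound [of x] r \<open>r > 0\<close> by (intro real_le_rsqrt) auto
    qed (use r in auto)
    then have "(cmod (h \<zeta>))\<^sup>2 \<le> (sqrt (C * (1 - r\<^sup>2)))\<^sup>2" by (simp add: power_mono)
    moreover have "0 \<le> C * (1 - r\<^sup>2)"
      using order_trans [OF zero_le_power2 bound [of "of_real r"]] r \<open>r > 0\<close> by simp
    ultimately show ?thesis by simp
  qed
  then have "eventually (\<lambda>r. (cmod (h \<zeta>))\<^sup>2 \<le> C * (1 - r\<^sup>2)) (at_left 1)"
    using \<zeta> by (auto simp: eventually_at_left)
  moreover have "((\<lambda>r. C * (1 - r\<^sup>2)) \<longlongrightarrow> C * (1 - 1\<^sup>2)) (at_left (1 :: real))"
    by (intro tendsto_intros)
  ultimately have "(cmod (h \<zeta>))\<^sup>2 \<le> C * (1 - 1\<^sup>2)"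
    by (intro tendsto_lowerbound) auto
  then show ?thesis by simp
qed

text \<open>The identity forces \<open>\<langle>\<phi> z, \<psi> z\<rangle> \<rightarrow> 1\<close> as \<open>|z| \<rightarrow> 1\<close>, so \<open>\<phi> - \<psi>\<close> vanishes at the sphere.\<close>

lemma self_maps_eq:
  fixes \<phi> \<psi> :: "complex ^ 'n \<Rightarrow> complex ^ 'n"
  assumes \<phi>: "analytic_self_map \<phi>" and \<psi>: "analytic_self_map \<psi>"
    and id: "\<And>z. z \<in> unit_ball \<Longrightarrow> (1 - cdot (\<phi> z) (\<psi> z)) * (1 - cdot (\<phi> 0) (\<psi> 0)) =
      (1 - cdot z z) * ((1 - cdot (\<phi> z) (\<psi> 0)) * (1 - cdot (\<phi> 0) (\<psi> z)))"
    and z: "z \<in> unit_ball"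
  shows "\<phi> z = \<psi> z"
proof -
  have ball: "\<phi> x \<in> unit_ball" "\<psi> x \<in> unit_ball" if "x \<in> unit_ball" for x
    using \<phi> \<psi> that unfolding analytic_self_map_def by blast+
  define c where "c = cmod (1 - cdot (\<phi> 0) (\<psi> 0))"
  have c: "c > 0" using one_minus_cdot_nz [of "\<phi> 0" "\<psi> 0"] ball [of 0] by (simp add: c_def)
  have le2: "cmod (1 - cdot x y) \<le> 2" if "x \<in> unit_ball" "y \<in> unit_ball" for x y :: "complex ^ 'n"
    using norm_triangle_ineq4 [of 1 "cdot x y"] norm_cdot_less_1 [OF that] by simp
  \<comment> \<open>As both norms are at most 1, expanding the square gives the factor 2; the two
    remaining factors of the identity have modulus at most 2 each, hence the 8.\<close>
  have bound: "(norm (\<phi> x - \<psi> x))\<^sup>2 \<le> 8 / c * (1 - (norm x)\<^sup>2)" if x: "x \<in> unit_ball" for x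
  proof -
    have 0: "(0 :: complex ^ 'n) \<in> unit_ball" by simp
    have "(norm (\<phi> x))\<^sup>2 \<le> 1" "(norm (\<psi> x))\<^sup>2 \<le> 1"
      using ball [OF x] by (simp_all add: abs_square_le_1)
    moreover have "(norm (\<phi> x - \<psi> x))\<^sup>2 = (norm (\<phi> x))\<^sup>2 + (norm (\<psi> x))\<^sup>2 - 2 * Re (cdot (\<phi> x) (\<psi> x))"
      unfolding Re_cdot power2_norm_eq_inner by (simp add: inner_commute algebra_simps)
    moreover have "Re (1 - cdot (\<phi> x) (\<psi> x)) \<le> cmod (1 - cdot (\<phi> x) (\<psi> x))"
      by (rule complex_Re_le_cmod)
    ultimately have "(norm (\<phi> x - \<psi> x))\<^sup>2 \<le> 2 * cmod (1 - cdot (\<phi> x) (\<psi> x))"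
      by simp
    moreover have "cmod (1 - cdot (\<phi> x) (\<psi> x)) * c \<le> (1 - (norm x)\<^sup>2) * (2 * 2)"
    proof -
      have x1: "1 - cdot x x = of_real (1 - (norm x)\<^sup>2)" by (simp add: cdot_self)
      have pos: "1 - (norm x)\<^sup>2 \<ge> 0" using x by (simp add: abs_square_le_1)
      have "cmod (1 - cdot (\<phi> x) (\<psi> x)) * c =
          (1 - (norm x)\<^sup>2) * (cmod (1 - cdot (\<phi> x) (\<psi> 0)) * cmod (1 - cdot (\<phi> 0) (\<psi> x)))"
        unfolding c_def norm_mult [symmetric] id [OF x]
        unfolding norm_mult x1 norm_of_real using pos by simp
      also have "\<dots> \<le> (1 - (norm x)\<^sup>2) * (2 * 2)"
        using pos ball [OF x] ball [OF 0] by (intro mult_left_mono mult_mono le2) auto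
      finally show ?thesis .
    qed
    ultimately have "(norm (\<phi> x - \<psi> x))\<^sup>2 * c \<le> 8 * (1 - (norm x)\<^sup>2)"
      using mult_right_mono [of "(norm (\<phi> x - \<psi> x))\<^sup>2" "2 * cmod (1 - cdot (\<phi> x) (\<psi> x))" c] c
      by linarith
    then show ?thesis using c by (simp add: field_simps)
  qed
  obtain u where u: "norm u = 1" "z = of_real (norm z) *s u" by (rule unit_vector_decomposition)
  show ?thesis
  proof (rule cdot_left_cancel)
    fix w :: "complex ^ 'n" assume w: "w \<in> unit_ball"
    let ?h = "\<lambda>\<zeta>. cdot (\<phi> (\<zeta> *s u)) w - cdot (\<psi> (\<zeta> *s u)) w"
    have "?h (of_real (norm z)) = 0"
    proof (rule holomorphic_vanishing_at_circle [where h = ?h and C = "8 / c"])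
      show "?h holomorphic_on ball 0 1"
        using \<phi> \<psi> u by (intro holomorphic_intros holomorphic_slice) (auto simp: analytic_self_map_def)
      show "(cmod (?h \<zeta>))\<^sup>2 \<le> 8 / c * (1 - (cmod \<zeta>)\<^sup>2)" if \<zeta>: "cmod \<zeta> < 1" for \<zeta>
      proof -
        let ?d = "\<phi> (\<zeta> *s u) - \<psi> (\<zeta> *s u)"
        have n: "norm (\<zeta> *s u) = cmod \<zeta>" using u by (simp add: norm_vector_scale)
        have "cmod (?h \<zeta>) \<le> norm ?d * norm w" using norm_cdot_le [of ?d w] by simp
        also have "\<dots> \<le> norm ?d" using w by (simp add: mult_left_le)
        finally have "(cmod (?h \<zeta>))\<^sup>2 \<le> (norm ?d)\<^sup>2" by (simp add: power_mono)
        also have "\<dots> \<le> 8 / c * (1 - (cmod \<zeta>)\<^sup>2)" using bound [of "\<zeta> *s u"] \<zeta> n by simp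
        finally show ?thesis .
      qed
    qed (use z in simp)
    then show "cdot (\<phi> z) w = cdot (\<psi> z) w" using u(2) by simp
  qed
qed

text \<open>The hypothesis has the shape of \<open>ball_involution_cdot\<close> at
  \<open>\<phi> 0\<close>; comparing the two and cancelling the nonzero \<open>?Q\<close> shows that
  the composite preserves \<open>cdot\<close>.\<close>

lemma ball_automorphism_if_kernel_identity:
  fixes \<phi> :: "complex ^ 'n \<Rightarrow> complex ^ 'n"
  assumes \<phi>: "analytic_self_map \<phi>"
    and id: "\<And>z w. z \<in> unit_ball \<Longrightarrow> w \<in> unit_ball \<Longrightarrow>
      (1 - cdot (\<phi> z) (\<phi> w)) * (1 - cdot (\<phi> 0) (\<phi> 0)) =
      (1 - cdot z w) * ((1 - cdot (\<phi> z) (\<phi> 0)) * (1 - cdot (\<phi> 0) (\<phi> w)))"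
  shows "ball_automorphism \<phi>"
proof (rule ball_automorphism_if_cdot_preserving [OF \<phi>])
  have ball: "\<phi> x \<in> unit_ball" if "x \<in> unit_ball" for x
    using \<phi> that unfolding analytic_self_map_def by blast
  show b: "\<phi> 0 \<in> unit_ball" by (rule ball) simp
  fix z w :: "complex ^ 'n" assume zw: "z \<in> unit_ball" "w \<in> unit_ball"
  let ?Q = "(1 - cdot (\<phi> z) (\<phi> 0)) * (1 - cdot (\<phi> 0) (\<phi> w))"
  have "(1 - cdot (ball_involution (\<phi> 0) (\<phi> z)) (ball_involution (\<phi> 0) (\<phi> w))) * ?Q =
      (1 - cdot z w) * ?Q"
    using ball_involution_cdot [OF b ball [OF zw(1)] ball [OF zw(2)]] id [OF zw]
    by (simp only: mult.commute)
  moreover have "?Q \<noteq> 0"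
    using one_minus_cdot_nz [OF ball [OF zw(1)] b] one_minus_cdot_nz [OF b ball [OF zw(2)]] by simp
  ultimately show "cdot (ball_involution (\<phi> 0) (\<phi> z)) (ball_involution (\<phi> 0) (\<phi> w)) = cdot z w"
    by simp
qed

section \<open>Weighted composition operators\<close>

context H_space
begin

abbreviation kernel :: "complex ^ 'n \<Rightarrow> complex ^ 'n \<Rightarrow> complex"
  where "kernel z \<equiv> extend0 unit_ball (ball_kernel \<gamma> z)"

text \<open>Pairing with a kernel is evaluation, and evaluating the image of \<open>v\<close> at
  \<open>w\<close> is \<open>g w\<close> times evaluating \<open>v\<close> at
  \<open>\<psi> w\<close>.\<close>

lemma adjoint_weighted_comp_kernel:
  assumes T: "bounded_operator_on H ip (weighted_comp g \<psi>)"
    and w: "w \<in> unit_ball" "\<psi> w \<in> unit_ball"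
  shows "adjoint_on H ip (weighted_comp g \<psi>) (kernel w) = (\<lambda>z. cnj (g w) * kernel (\<psi> w) z)"
proof (rule adjoint_on_eqI)
  show "(\<lambda>z. cnj (g w) * kernel (\<psi> w) z) \<in> H"
    using w by (intro scale_mem kernel_mem)
  fix v assume v: "v \<in> H"
  then have "weighted_comp g \<psi> v \<in> H" using T by (simp add: bounded_operator_on_def)
  then have "ip (weighted_comp g \<psi> v) (kernel w) = weighted_comp g \<psi> v w"
    using reproducing w by simp
  also have "\<dots> = g w * v (\<psi> w)" using w by (simp add: weighted_comp_def extend0_def)
  also have "\<dots> = ip v (\<lambda>z. cnj (g w) * kernel (\<psi> w) z)"
    using ip_scale_right [OF kernel_mem [OF w(2)] v, of "cnj (g w)"] reproducing [OF v w(2)] by simp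
  finally show "ip (weighted_comp g \<psi> v) (kernel w) = ip v (\<lambda>z. cnj (g w) * kernel (\<psi> w) z)" .
qed

lemma kernel_identity_if_right_inverse:
  assumes T: "bounded_operator_on H ip (weighted_comp g \<psi>)"
    and \<phi>: "\<phi> ` unit_ball \<subseteq> unit_ball" and \<psi>: "\<psi> ` unit_ball \<subseteq> unit_ball"
    and inv: "\<forall>h\<in>H. weighted_comp f \<phi> (adjoint_on H ip (weighted_comp g \<psi>) h) = h"
    and z: "z \<in> unit_ball" and w: "w \<in> unit_ball"
  shows "f z * cnj (g w) * ball_kernel \<gamma> (\<psi> w) (\<phi> z) = ball_kernel \<gamma> w z"
proof -
  have \<phi>z: "\<phi> z \<in> unit_ball" and \<psi>w: "\<psi> w \<in> unit_ball" using \<phi> \<psi> z w by blast+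
  have "weighted_comp f \<phi> (\<lambda>z. cnj (g w) * kernel (\<psi> w) z) z = kernel w z"
    using inv kernel_mem [OF w] adjoint_weighted_comp_kernel [OF T w \<psi>w] by metis
  then show ?thesis
    using z \<phi>z by (simp add: weighted_comp_def extend0_def mult_ac)
qed

text \<open>Conjugated, the identity says that \<open>weighted_comp g \<psi>\<close> maps
  \<open>kernel (\<phi> z)\<close>, up to the factor \<open>cnj (f z)\<close>, to
  \<open>kernel z\<close>. The reproducing property then treats an arbitrary \<open>h\<close>
  directly, with no density argument.\<close>

lemma right_inverse_if_kernel_identity:
  assumes T: "bounded_operator_on H ip (weighted_comp g \<psi>)"
    and \<phi>: "\<phi> ` unit_ball \<subseteq> unit_ball" and \<psi>: "\<psi> ` unit_ball \<subseteq> unit_ball"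
    and id: "\<And>z w. z \<in> unit_ball \<Longrightarrow> w \<in> unit_ball \<Longrightarrow>
      f z * cnj (g w) * ball_kernel \<gamma> (\<psi> w) (\<phi> z) = ball_kernel \<gamma> w z"
    and h: "h \<in> H"
  shows "weighted_comp f \<phi> (adjoint_on H ip (weighted_comp g \<psi>) h) = h"
proof
  let ?T = "weighted_comp g \<psi>"
  let ?u = "adjoint_on H ip ?T h"
  note adj = adjoint_on_properties [OF T h]
  fix z
  show "weighted_comp f \<phi> ?u z = h z"
  proof (cases "z \<in> unit_ball")
    case True
    then have \<phi>z: "\<phi> z \<in> unit_ball" using \<phi> by blast
    have T_mem: "?T (kernel (\<phi> z)) \<in> H"
      using T kernel_mem [OF \<phi>z] by (simp add: bounded_operator_on_def)
    have "(\<lambda>w. cnj (f z) * ?T (kernel (\<phi> z)) w) = kernel z"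
    proof
      fix w
      show "cnj (f z) * ?T (kernel (\<phi> z)) w = kernel z w"
      proof (cases "w \<in> unit_ball")
        case w: True
        then have \<psi>w: "\<psi> w \<in> unit_ball" using \<psi> by blast
        from id [OF True w]
        have "cnj (f z * cnj (g w) * ball_kernel \<gamma> (\<psi> w) (\<phi> z)) = cnj (ball_kernel \<gamma> w z)" by simp
        then show ?thesis
          using cnj_ball_kernel [OF \<psi>w \<phi>z] cnj_ball_kernel [OF w True] w \<psi>w
          by (simp add: weighted_comp_def extend0_def mult_ac)
      qed (simp add: weighted_comp_def extend0_def)
    qed
    then have "h z = ip h (\<lambda>w. cnj (f z) * ?T (kernel (\<phi> z)) w)"
      using reproducing [OF h True] by simp
    also have "\<dots> = f z * ip h (?T (kernel (\<phi> z)))"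
      using ip_scale_right [OF T_mem h, of "cnj (f z)"] by simp
    also have "ip h (?T (kernel (\<phi> z))) = cnj (ip (?T (kernel (\<phi> z))) h)"
      using ip_cnj T_mem h by blast
    also have "ip (?T (kernel (\<phi> z))) h = ip (kernel (\<phi> z)) ?u"
      using adj(2) kernel_mem [OF \<phi>z] by blast
    also have "cnj (ip (kernel (\<phi> z)) ?u) = ip ?u (kernel (\<phi> z))"
      using ip_cnj adj(1) kernel_mem [OF \<phi>z] by metis
    also have "\<dots> = ?u (\<phi> z)" using reproducing [OF adj(1) \<phi>z] by simp
    finally show ?thesis using True by (simp add: weighted_comp_def extend0_def)
  next
    case False
    then show ?thesis using vanish_outside [OF h False] by (simp add: weighted_comp_def extend0_def)
  qed
qed

end

lemma weighted_comp_scale: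
  assumes "\<And>z. z \<in> unit_ball \<Longrightarrow> f z = c * k z"
  shows "weighted_comp f \<phi> h = (\<lambda>z. c * weighted_comp k \<phi> h z)"
  using assms by (simp add: weighted_comp_def extend0_def fun_eq_iff)

lemma weighted_comp_cong:
  assumes "\<And>z. z \<in> unit_ball \<Longrightarrow> \<phi> z = \<psi> z"
  shows "weighted_comp f \<phi> = weighted_comp f \<psi>"
  using assms by (simp add: weighted_comp_def extend0_def fun_eq_iff)

text \<open>Since \<open>\<phi> a = 0\<close>, putting \<open>a\<close> for either variable makes
  the kernel factor on the left 1, so both weights are multiples of
  \<open>ball_kernel \<gamma> a\<close>; the instance with both variables at \<open>a\<close> links
  the two constants.\<close>

lemma weights_are_normalized_kernels:
  assumes a: "a \<in> unit_ball" "\<phi> a = 0"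
    and id: "\<And>z w. z \<in> unit_ball \<Longrightarrow> w \<in> unit_ball \<Longrightarrow>
      f z * cnj (g w) * ball_kernel \<gamma> (\<phi> w) (\<phi> z) = ball_kernel \<gamma> w z"
  obtains l where "l \<noteq> 0"
    "\<And>z. z \<in> unit_ball \<Longrightarrow> f z = l * normalized_kernel \<gamma> a z \<and> g z = (1 / cnj l) * normalized_kernel \<gamma> a z"
proof -
  define t where "t = 1 - (norm a)\<^sup>2"
  define r where "r = complex_of_real (t powr (\<gamma> / 2))"
  have t: "t > 0" using a by (simp add: t_def abs_square_less_1)
  then have r: "r \<noteq> 0" "cnj r = r" by (simp_all add: r_def)
  have "t powr (\<gamma> / 2) * t powr (\<gamma> / 2) * t powr (- \<gamma>) = 1"
    using t by (simp flip: powr_add)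
  moreover have "ball_kernel \<gamma> a a = of_real (t powr (- \<gamma>))"
  proof -
    have "1 - cdot a a = of_real t" by (simp add: t_def cdot_self)
    then show ?thesis using t powr_of_real [of t "- \<gamma>"] by (simp add: ball_kernel_def)
  qed
  ultimately have r2: "r * r * ball_kernel \<gamma> a a = 1"
    unfolding r_def by (metis of_real_1 of_real_mult)
  have fa: "f z * cnj (g a) = ball_kernel \<gamma> a z" if "z \<in> unit_ball" for z
    using id [OF that a(1)] a by simp
  have ga: "cnj (f a) * g z = ball_kernel \<gamma> a z" if "z \<in> unit_ball" for z
  proof -
    have "cnj (f a * cnj (g z)) = cnj (ball_kernel \<gamma> z a)" using id [OF a(1) that] a by simp
    then show ?thesis using cnj_ball_kernel [OF that a(1)] by simp
  qed
  have nz: "f a \<noteq> 0" "g a \<noteq> 0" using fa [OF a(1)] ball_kernel_nz [OF a(1) a(1), of \<gamma>] by auto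
  have k: "normalized_kernel \<gamma> a z = r * ball_kernel \<gamma> a z" for z
    by (simp add: normalized_kernel_def r_def t_def)
  have one: "f a * r * (r * cnj (g a)) = 1" using r2 fa [OF a(1)] by (simp add: mult_ac)
  show thesis
  \<comment> \<open>The constant is \<open>f a\<close> divided by
    \<open>normalized_kernel \<gamma> a a\<close>, which is \<open>1 / r\<close>.\<close>
  proof (rule that [of "f a * r"])
    show "f a * r \<noteq> 0" using nz r by simp
    fix z :: "complex ^ 'a" assume z: "z \<in> unit_ball"
    have "f a * r * normalized_kernel \<gamma> a z = f z * (f a * r * (r * cnj (g a)))"
      by (simp add: k mult_ac flip: fa [OF z])
    moreover have "(1 / cnj (f a * r)) * normalized_kernel \<gamma> a z = g z"
      using nz r by (simp add: k flip: ga [OF z])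
    ultimately show "f z = f a * r * normalized_kernel \<gamma> a z \<and>
        g z = (1 / cnj (f a * r)) * normalized_kernel \<gamma> a z"
      by (simp add: one)
  qed
qed

theorem theorem3p5:
  fixes \<gamma> :: real
    and H :: "(complex ^ 'n \<Rightarrow> complex) set"
    and ip :: "(complex ^ 'n \<Rightarrow> complex) \<Rightarrow> (complex ^ 'n \<Rightarrow> complex) \<Rightarrow> complex"
    and f g :: "complex ^ 'n \<Rightarrow> complex"
    and \<phi> \<psi> :: "complex ^ 'n \<Rightarrow> complex ^ 'n"
  assumes "\<gamma> > 0"
    and "H_space \<gamma> H ip"
    and "analytic_fun_on unit_ball f" and "analytic_fun_on unit_ball g"
    and "analytic_self_map \<phi>" and "analytic_self_map \<psi>"
    and "bounded_operator_on H ip (weighted_comp f \<phi>)"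
    and "bounded_operator_on H ip (weighted_comp g \<psi>)"
  shows "((\<forall>h\<in>H. weighted_comp f \<phi> (adjoint_on H ip (weighted_comp g \<psi>) h) = h) \<longleftrightarrow>
      (\<forall>z\<in>unit_ball. \<phi> z = \<psi> z) \<and> ball_automorphism \<phi> \<and>
      (let a = inv_into unit_ball \<phi> 0 in
        \<exists>l::complex. l \<noteq> 0 \<and>
          (\<forall>z\<in>unit_ball. f z = l * normalized_kernel \<gamma> a z \<and>
                          g z = (1 / cnj l) * normalized_kernel \<gamma> a z)))
    \<and> ((\<forall>h\<in>H. weighted_comp f \<phi> (adjoint_on H ip (weighted_comp g \<psi>) h) = h) \<longrightarrow>
      (let W = weighted_comp (normalized_kernel \<gamma> (inv_into unit_ball \<phi> 0)) \<phi> in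
        unitary_on H ip W \<and>
        (\<exists>c. \<forall>h\<in>H. weighted_comp f \<phi> h = (\<lambda>z. c * W h z)) \<and>
        (\<exists>d. \<forall>h\<in>H. weighted_comp g \<psi> h = (\<lambda>z. d * W h z))))"
proof -
  interpret H_space \<gamma> H ip by fact
  let ?T = "weighted_comp f \<phi>" and ?S = "weighted_comp g \<psi>"
  let ?a = "inv_into unit_ball \<phi> 0"
  let ?k = "normalized_kernel \<gamma> ?a"
  let ?coinverse = "\<forall>h\<in>H. ?T (adjoint_on H ip ?S h) = h"
  let ?param = "\<lambda>l. l \<noteq> 0 \<and> (\<forall>z\<in>unit_ball. f z = l * ?k z \<and> g z = (1 / cnj l) * ?k z)"
  note \<phi> = \<open>analytic_self_map \<phi>\<close> and \<psi> = \<open>analytic_self_map \<psi>\<close>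
  note T = \<open>bounded_operator_on H ip ?T\<close> and S = \<open>bounded_operator_on H ip ?S\<close>
  have maps: "\<phi> ` unit_ball \<subseteq> unit_ball" "\<psi> ` unit_ball \<subseteq> unit_ball"
    using \<phi> \<psi> by (simp_all add: analytic_self_map_def)
  have a: "?a \<in> unit_ball" "\<phi> ?a = 0" if "ball_automorphism \<phi>"
  proof -
    have "\<phi> ` unit_ball = unit_ball" using that by (auto simp: ball_automorphism_def bij_betw_def)
    then have "0 \<in> \<phi> ` unit_ball" by simp
    then show "?a \<in> unit_ball" "\<phi> ?a = 0" by (rule inv_into_into, rule f_inv_into_f)
  qed
  have k_id: "?k z * cnj (?k w) * ball_kernel \<gamma> (\<phi> w) (\<phi> z) = ball_kernel \<gamma> w z"
    if "ball_automorphism \<phi>" "z \<in> unit_ball" "w \<in> unit_ball" for z w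
    using that a [OF that(1)] maps
    by (intro normalized_kernel_identity ball_automorphism_cdot) blast+
  have forward: "(\<forall>z\<in>unit_ball. \<phi> z = \<psi> z) \<and> ball_automorphism \<phi> \<and> (\<exists>l. ?param l)" if ?coinverse
  proof -
    note id = kernel_identity_if_right_inverse [OF S maps that]
    note id' = kernel_identity_without_exponent [OF \<phi> \<psi> \<open>\<gamma> > 0\<close> id]
    have eq: "\<phi> z = \<psi> z" if "z \<in> unit_ball" for z
      by (rule self_maps_eq [OF \<phi> \<psi> id' that])
    have aut: "ball_automorphism \<phi>"
    proof (rule ball_automorphism_if_kernel_identity [OF \<phi>])
      fix z w :: "complex ^ 'n" assume "z \<in> unit_ball" "w \<in> unit_ball"
      with id' [of z w] show "(1 - cdot (\<phi> z) (\<phi> w)) * (1 - cdot (\<phi> 0) (\<phi> 0)) =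
          (1 - cdot z w) * ((1 - cdot (\<phi> z) (\<phi> 0)) * (1 - cdot (\<phi> 0) (\<phi> w)))"
        using eq [of w] eq [of 0] by simp
    qed
    have "f z * cnj (g w) * ball_kernel \<gamma> (\<phi> w) (\<phi> z) = ball_kernel \<gamma> w z"
      if "z \<in> unit_ball" "w \<in> unit_ball" for z w
      using id [OF that] eq [OF that(2)] by simp
    from weights_are_normalized_kernels [OF a [OF aut] this] obtain l where "?param l" by metis
    with eq aut show ?thesis by blast
  qed
  have backward: ?coinverse
    if eq: "\<forall>z\<in>unit_ball. \<phi> z = \<psi> z" and aut: "ball_automorphism \<phi>" and l: "?param l" for l
  proof
    fix h assume h: "h \<in> H"
    show "?T (adjoint_on H ip ?S h) = h"
    proof (rule right_inverse_if_kernel_identity [OF S maps _ h])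
      fix z w :: "complex ^ 'n" assume zw: "z \<in> unit_ball" "w \<in> unit_ball"
      have "f z * cnj (g w) = ?k z * cnj (?k w)"
        using l zw by simp
      then show "f z * cnj (g w) * ball_kernel \<gamma> (\<psi> w) (\<phi> z) = ball_kernel \<gamma> w z"
        using k_id [OF aut zw] eq zw by simp
    qed
  qed
  have unitary: "unitary_on H ip (weighted_comp ?k \<phi>)"
    "\<exists>c. \<forall>h\<in>H. ?T h = (\<lambda>z. c * weighted_comp ?k \<phi> h z)"
    "\<exists>d. \<forall>h\<in>H. ?S h = (\<lambda>z. d * weighted_comp ?k \<phi> h z)" if coinverse: ?coinverse
  proof -
    obtain l where eq: "\<forall>z\<in>unit_ball. \<phi> z = \<psi> z" and aut: "ball_automorphism \<phi>" and l: "?param l"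
      using forward [OF coinverse] by blast
    have bij: "\<phi> ` unit_ball = unit_ball" using aut by (auto simp: ball_automorphism_def bij_betw_def)
    \<comment> \<open>On the diagonal the kernel identity has a nonzero right side, so the weight
      cannot vanish.\<close>
    have k_nz: "?k z \<noteq> 0" if "z \<in> unit_ball" for z
      using k_id [OF aut that that] ball_kernel_nz [OF that that, of \<gamma>] by auto
    \<comment> \<open>Boundedness is inherited from \<open>?T\<close>, of which this operator is the
      multiple by \<open>1 / l\<close>.\<close>
    have W: "bounded_operator_on H ip (weighted_comp ?k \<phi>)"
      using T by (rule bounded_operator_on_scale [where c = "1 / l"], intro weighted_comp_scale) (use l in simp)
    show "unitary_on H ip (weighted_comp ?k \<phi>)"
    proof (rule unitary_on_if_coisometry [OF W])
      show "weighted_comp ?k \<phi> (adjoint_on H ip (weighted_comp ?k \<phi>) h) = h" if "h \<in> H" for h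
        using W maps(1) maps(1) k_id [OF aut] that by (rule right_inverse_if_kernel_identity)
      \<comment> \<open>Injectivity: the nonvanishing weight can be divided out, and \<phi> maps
        onto the ball.\<close>
      fix h k assume hk: "h \<in> H" "k \<in> H" and W_eq: "weighted_comp ?k \<phi> h = weighted_comp ?k \<phi> k"
      show "h = k"
      proof
        fix x
        show "h x = k x"
        proof (cases "x \<in> unit_ball")
          case True
          then obtain z where z: "z \<in> unit_ball" "x = \<phi> z" using bij by blast
          with fun_cong [OF W_eq, of z] k_nz [OF z(1)] show ?thesis
            by (simp add: weighted_comp_def extend0_def)
        qed (simp add: vanish_outside [OF hk(1)] vanish_outside [OF hk(2)])
      qed
    qed
    show "\<exists>c. \<forall>h\<in>H. ?T h = (\<lambda>z. c * weighted_comp ?k \<phi> h z)"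
      by (intro exI ballI weighted_comp_scale) (use l in blast)
    \<comment> \<open>The two maps may differ off the ball, but \<open>weighted_comp\<close> does
      not see their values there.\<close>
    have "?S = weighted_comp g \<phi>" using eq by (intro weighted_comp_cong) simp
    moreover have "weighted_comp g \<phi> h = (\<lambda>z. 1 / cnj l * weighted_comp ?k \<phi> h z)" for h
      by (rule weighted_comp_scale) (use l in blast)
    ultimately show "\<exists>d. \<forall>h\<in>H. ?S h = (\<lambda>z. d * weighted_comp ?k \<phi> h z)"
      by metis
  qed
  show ?thesis
    unfolding Let_def using forward backward unitary by blast
qed

end
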